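(* For every $\tilde\beta\in[0,1)$ and every $p\ge1$ there exist constants $C_p=C_p(\tilde\beta)>0$ and $C=C(\tilde\beta)>0$ such that for every $N\ge3$ and every $q\in\mathbb{T}$ $$d_{\mathrm H}^{p}\left(\mu^N\big(W^{\mathrm u}(\theta^N_q)_{\tilde\beta}\big),\ \mathcal{M}_{\mathrm{OA},\tilde\beta}\right)\le\frac{C_p}{N}\qquad\text{and}\qquad d_{\mathrm H}^{\infty}\left(L_N\big(W^{\mathrm u}(\theta^N_q)_{\tilde\beta}\big),\ W^{\mathrm u}(y_{q-\pi})_{\tilde\beta}\right)\le\frac{C}{N}.$$
   Context: $\mathbb{T}=\mathbb{R}/2\pi\mathbb{Z}=\mathbb{S}^1$ with the arc-length distance. $W_p$ is the $p$-Wasserstein distance on probability measures on $\mathbb{T}$; $d_{\mathrm H}^p$ is the Hausdorff distance between sets of probability measures induced by $W_p$; $d_{\mathrm H}^\infty$ is the Hausdorff distance between sets of ($\mathbb{T}$-valued) functions on $[0,1]$ induced by the $L^\infty$ (essential supremum) distance. Finite-dimensional manifold. For $\alpha,A\in\mathbb{R}$, $\beta\in[0,1)$, $\xi\in[0,1]$ let $$\phi(\alpha,\beta,A,\xi)=2\arctan\left(\frac{1-\beta}{1+\beta}\tan(\pi\xi+A)\right)-\alpha+2\pi k,$$ with $k\in\mathbb{Z}$ such that $\pi\xi+A\in[\pi(k-\frac12),\pi(k+\frac12)]$ (extended by continuity where $\tan$ is infinite), and $\phi_i(\alpha,\beta,A)=\phi(\alpha,\beta,A,\frac{2i-1}{2N})$.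 $W^{\mathrm u}(\theta^N_q)_{\tilde\beta}$ is the set of $\theta\in\mathbb{T}^N$ with $\theta_i=\phi_i(\alpha,\beta,A)$ mod $2\pi$ for some $\beta\in[0,\tilde\beta]$, $\alpha\in[-\pi,\pi]$, $A\in[-\frac\pi2,\frac\pi2]$ satisfying $\frac1N\sum_i\phi_i(\alpha,\beta,A)=q$ mod $2\pi$. (With $\tilde\beta$ replaced by all $\beta<1$ this is the unstable manifold of the equilibrium $\theta_q^N=(\frac{\pi(2i-1-N)}{N}+q)_i$ of the Kuramoto model $\dot\theta_i=\frac KN\sum_j\sin(\theta_j-\theta_i)$.) Ott–Antonsen manifold. For $\alpha\in[-\pi,\pi]$, $\beta\in[0,1)$ let $$f_{\alpha,\beta}(\theta)=\frac1{2\pi}\frac{1-\beta^2}{1-2\beta\cos(\alpha+\theta)+\beta^2},$$ a probability density on $\mathbb{T}$, identified with the measure $f_{\alpha,\beta}\,d\theta$; $\mathcal{M}_{\mathrm{OA},\tilde\beta}=\{f_{\alpha,\beta}:\beta\in[0,\tilde\beta],\ \alpha\in[-\pi,\pi]\}$. Continuum-limit manifold. Let $F_{\alpha,\beta}(x)=\int_0^x f_{\alpha,\beta}(\theta)\,d\theta$ for $x\in\mathbb{R}$, an increasing bijection of $\mathbb{R}$ with $F_{\alpha,\beta}(x+2\pi)=F_{\alpha,\beta}(x)+1$, with inverse $F_{\alpha,\beta}^{-1}$, and $C(\alpha,\beta)=-\frac1\pi\arctan\left(\frac{\beta\sin\alpha}{1-\beta\cos\alpha}\right)$. For $q\in\mathbb{T}$,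 with $y_q(\xi)=2\pi\xi+q$, $W^{\mathrm u}(y_q)_{\tilde\beta}$ is the set of functions $[0,1]\to\mathbb{T}$ given by $\xi\mapsto F^{-1}_{\alpha,\beta}\left(\xi+C(\alpha,\beta)+\frac q{2\pi}\right)$ mod $2\pi$, with $\beta\in[0,\tilde\beta]$, $\alpha\in[-\pi,\pi]$. Lifts. $\mu^N(x)=\frac1N\sum_{i=1}^N\delta_{x_i}$, and $L_N(x)$ is the step function on $[0,1]$ equal to $x_i$ on $[\frac{i-1}N,\frac iN)$ for $i<N$ and to $x_N$ on $[\frac{N-1}{N},1]$; both are applied elementwise to sets. *)

theory Defs
  imports "HOL-Probability.Probability" "HOL-Library.Real_Mod"
begin

section \<open>The circle\<close>

quotient_type circle = real / "\<lambda>x y. [x = y] (rmod (2 * pi))"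
  morphisms rep_circle to_circle
  by (intro equivpI reflpI sympI transpI) (auto intro: rcong_sym rcong_trans)

lemma to_circle_eq_iff: "to_circle x = to_circle y \<longleftrightarrow> [x = y] (rmod (2 * pi))"
  by (simp add: circle.abs_eq_iff)

lemma to_circle_eq_iff': "to_circle x = to_circle y \<longleftrightarrow> (\<exists>k::int. y = x + 2 * pi * k)"
  by (simp add: to_circle_eq_iff rcong_altdef mult.commute)

lemma to_circle_surj: "\<exists>x. to_circle x = p"
  by (metis Quotient_abs_rep[OF Quotient_circle])

instantiation circle :: ab_group_add
begin

lift_definition zero_circle :: circle is 0 .
lift_definition plus_circle :: "circle \<Rightarrow> circle \<Rightarrow> circle" is "(+)" by (rule rcong_add)
lift_definition minus_circle :: "circle \<Rightarrow> circle \<Rightarrow> circle" is "(-)" by (rule rcong_diff)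
lift_definition uminus_circle :: "circle \<Rightarrow> circle" is "uminus" by (rule rcong_uminus)

instance
  by (intro_classes; transfer) (simp_all add: algebra_simps)

end

text \<open>The arc-length distance is the quotient metric of the one on the line.\<close>

instantiation circle :: metric_space
begin

definition dist_circle :: "circle \<Rightarrow> circle \<Rightarrow> real" where
  "dist_circle p q = Inf {\<bar>x - y\<bar> | x y. to_circle x = p \<and> to_circle y = q}"

definition uniformity_circle :: "(circle \<times> circle) filter" where
  "uniformity_circle = (INF e\<in>{0<..}. principal {(p, q). dist p q < e})"

definition open_circle :: "circle set \<Rightarrow> bool" where
  "open_circle U \<longleftrightarrow> (\<forall>p\<in>U. \<forall>\<^sub>F (p', q) in uniformity. p' = p \<longrightarrow> q \<in> U)"

lemma dist_circle_le: "dist (to_circle x) (to_circle y) \<le> \<bar>x - y\<bar>"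
  unfolding dist_circle_def by (rule cInf_lower) (auto intro!: bdd_belowI[of _ 0])

lemma dist_circle_attained:
  "\<exists>y. to_circle y = q \<and> dist (to_circle x) q = \<bar>x - y\<bar> \<and> \<bar>x - y\<bar> \<le> pi"
proof -
  obtain z where z: "to_circle z = q"
    using to_circle_surj by blast
  define k where "k = round ((x - z) / (2 * pi))"
  define y where "y = z + 2 * pi * k"
  have yq: "to_circle y = q"
  proof -
    have "to_circle z = to_circle y"
      unfolding to_circle_eq_iff' y_def by blast
    thus ?thesis by (simp only: z)
  qed
  have "\<bar>of_int k - (x - z) / (2 * pi)\<bar> \<le> 1 / 2"
    unfolding k_def by (rule of_int_round_abs_le)
  hence "\<bar>(x - y) / (2 * pi)\<bar> \<le> 1 / 2"
    by (simp add: y_def field_simps abs_minus_commute)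
  hence le: "\<bar>x - y\<bar> \<le> pi"
    by (simp add: abs_divide divide_le_eq)
  have "dist (to_circle x) q = \<bar>x - y\<bar>"
    unfolding dist_circle_def
  proof (rule cInf_eq_minimum)
    show "\<bar>x - y\<bar> \<in> {\<bar>x' - y'\<bar> |x' y'. to_circle x' = to_circle x \<and> to_circle y' = q}"
      using yq by blast
  next
    fix r assume "r \<in> {\<bar>x' - y'\<bar> |x' y'. to_circle x' = to_circle x \<and> to_circle y' = q}"
    then obtain x' y' where r: "r = \<bar>x' - y'\<bar>" "to_circle x' = to_circle x" "to_circle y' = q"
      by blast
    obtain i :: int where i: "x' = x + 2 * pi * i"
      using r(2)[symmetric] unfolding to_circle_eq_iff' ..
    have "to_circle y = to_circle y'"
      by (simp only: yq r(3))
    then obtain j :: int where j: "y' = y + 2 * pi * j"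
      unfolding to_circle_eq_iff' ..
    have eq: "x' - y' = (x - y) + 2 * pi * of_int (i - j)"
      by (simp add: i j algebra_simps)
    show "\<bar>x - y\<bar> \<le> r"
    proof (cases "i = j")
      case True
      thus ?thesis using eq r by simp
    next
      case False
      hence "1 \<le> \<bar>real_of_int (i - j)\<bar>"
        by linarith
      hence "2 * pi * 1 \<le> 2 * pi * \<bar>real_of_int (i - j)\<bar>"
        by (intro mult_left_mono) auto
      hence "2 * pi \<le> \<bar>2 * pi * real_of_int (i - j)\<bar>"
        by (simp add: abs_mult)
      thus ?thesis using le eq r(1) by linarith
    qed
  qed
  with yq le show ?thesis by blast
qed

instance
proof
  fix p q r :: circle
  obtain x where x: "to_circle x = p"
    using to_circle_surj by blast
  show "dist p q = 0 \<longleftrightarrow> p = q"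
  proof
    assume "dist p q = 0"
    thus "p = q" using dist_circle_attained[of q x] x by auto
  next
    assume "p = q"
    moreover obtain y where "dist p q = \<bar>x - y\<bar>"
      using dist_circle_attained[of q x] x by blast
    ultimately show "dist p q = 0"
      using dist_circle_le[of x x] x by simp
  qed
  have comm: "dist a b = dist b a" for a b :: circle
  proof -
    obtain u v where u: "to_circle u = a" "dist b a = \<bar>v - u\<bar>" "to_circle v = b"
      by (metis dist_circle_attained to_circle_surj)
    obtain u' v' where u': "to_circle u' = a" "dist a b = \<bar>u' - v'\<bar>" "to_circle v' = b"
      by (metis dist_circle_attained to_circle_surj)
    show ?thesis
      using dist_circle_le[of u v] dist_circle_le[of v' u'] u u' by simp
  qed
  obtain z where z: "to_circle z = r"
    using to_circle_surj by blast
  obtain y where y: "to_circle y = p" "dist r p = \<bar>z - y\<bar>"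
    using dist_circle_attained[of p z] z by blast
  obtain w where w: "to_circle w = q" "dist r q = \<bar>z - w\<bar>"
    using dist_circle_attained[of q z] z by blast
  have "dist p q \<le> \<bar>y - w\<bar>"
    using dist_circle_le[of y w] y w by simp
  also have "\<dots> \<le> dist p r + dist q r"
    using y w comm[of p r] comm[of q r] by linarith
  finally show "dist p q \<le> dist p r + dist q r" .
qed (simp_all add: uniformity_circle_def open_circle_def)

end

instance circle :: second_countable_topology
proof
  define B where "B = (\<lambda>(a, e). ball (to_circle a) e) ` (\<rat> \<times> \<rat> :: (real \<times> real) set)"
  have "countable B"
    unfolding B_def by (intro countable_image countable_SIGMA countable_rat)
  moreover have "topological_basis B"
  proof (rule topological_basisI)
    fix U :: "circle set" and p assume U: "open U" "p \<in> U"
    then obtain e where e: "e > 0" "ball p e \<subseteq> U"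
      by (meson openE)
    obtain x where x: "to_circle x = p"
      using to_circle_surj by blast
    obtain s where s: "s \<in> \<rat>" "0 < s" "s < e / 2"
      using Rats_dense_in_real[of 0 "e / 2"] e by auto
    obtain a where a: "a \<in> \<rat>" "x < a" "a < x + s"
      using Rats_dense_in_real[of x "x + s"] s by auto
    have "dist (to_circle a) p < s"
      using dist_circle_le[of a x] x a by simp
    hence "p \<in> ball (to_circle a) s" "ball (to_circle a) s \<subseteq> ball p e"
      using s by (auto simp: dist_commute) (smt (verit) dist_commute dist_triangle)
    moreover have "ball (to_circle a) s \<in> B"
      using a s by (auto simp: B_def)
    ultimately show "\<exists>B'\<in>B. p \<in> B' \<and> B' \<subseteq> U"
      using e by blast
  qed (auto simp: B_def)
  ultimately show "\<exists>B :: circle set set. countable B \<and> open = generate_topology B"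
    using topological_basis_imp_subbasis by blast
qed

lemma continuous_to_circle: "continuous_on A to_circle"
  unfolding continuous_on_iff
  by (metis dist_circle_le dist_real_def order_le_less_trans)

lemma borel_measurable_to_circle [measurable]: "to_circle \<in> borel_measurable borel"
  by (rule borel_measurable_continuous_onI) (rule continuous_to_circle)

section \<open>Wasserstein and Hausdorff distances\<close>

definition couplings ::
    "'a::{metric_space, second_countable_topology} measure \<Rightarrow> 'a measure \<Rightarrow> ('a \<times> 'a) measure set" where
  "couplings \<mu> \<nu> = {\<gamma>. sets \<gamma> = sets (borel \<Otimes>\<^sub>M borel) \<and> distr \<gamma> borel fst = \<mu> \<and> distr \<gamma> borel snd = \<nu>}"

definition ennreal_powr :: "ennreal \<Rightarrow> real \<Rightarrow> ennreal" where
  "ennreal_powr x a = (if x = \<infinity> then \<infinity> else ennreal (enn2real x powr a))"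

definition wasserstein ::
    "real \<Rightarrow> 'a::{metric_space, second_countable_topology} measure \<Rightarrow> 'a measure \<Rightarrow> ennreal" where
  "wasserstein p \<mu> \<nu> =
     ennreal_powr (INF \<gamma>\<in>couplings \<mu> \<nu>. \<integral>\<^sup>+ (x, y). ennreal (dist x y powr p) \<partial>\<gamma>) (1 / p)"

definition linf_dist :: "(real \<Rightarrow> circle) \<Rightarrow> (real \<Rightarrow> circle) \<Rightarrow> ennreal" where
  "linf_dist f g = esssup (lebesgue_on {0..1}) (\<lambda>\<xi>. ennreal (dist (f \<xi>) (g \<xi>)))"

definition hausdorff_dist :: "('a \<Rightarrow> 'a \<Rightarrow> ennreal) \<Rightarrow> 'a set \<Rightarrow> 'a set \<Rightarrow> ennreal" where
  "hausdorff_dist d A B = max (SUP a\<in>A. INF b\<in>B. d a b) (SUP b\<in>B. INF a\<in>A. d a b)"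

section \<open>The finite-dimensional manifold\<close>

text \<open>
  The integer \<open>k = \<lfloor>u / \<pi> + 1/2\<rfloor>\<close> satisfies \<open>\<pi> (k - 1/2) \<le> u < \<pi> (k + 1/2)\<close>.  At the poles
  \<open>u = \<pi> (k - 1/2)\<close> of the tangent both one-sided limits of
  \<open>2 arctan (r tan u) + 2 \<pi> k\<close> are \<open>2 u\<close>, which is the value taken there;
  see \<open>isCont_phi\<close> below.  (In HOL, \<open>tan\<close> is \<open>0\<close> at its poles.)
\<close>

definition phi :: "real \<Rightarrow> real \<Rightarrow> real \<Rightarrow> real \<Rightarrow> real" where
  "phi \<alpha> \<beta> A \<xi> =
     (let u = pi * \<xi> + A; k = \<lfloor>u / pi + 1 / 2\<rfloor> in
      if cos u = 0 then 2 * u - \<alpha>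
      else 2 * arctan ((1 - \<beta>) / (1 + \<beta>) * tan u) - \<alpha> + 2 * pi * of_int k)"

definition phi_i :: "nat \<Rightarrow> nat \<Rightarrow> real \<Rightarrow> real \<Rightarrow> real \<Rightarrow> real" where
  "phi_i N i \<alpha> \<beta> A = phi \<alpha> \<beta> A ((2 * real i - 1) / (2 * real N))"

lemma isCont_phi:
  assumes "\<beta> \<in> {0..<1}"
  shows "isCont (phi \<alpha> \<beta> A) \<xi>"
proof -
  define r where "r = (1 - \<beta>) / (1 + \<beta>)"
  define h where "h x = 2 * arctan (r * tan x) + 2 * pi * of_int \<lfloor>x / pi + 1 / 2\<rfloor>" for x
  define g where "g x = (if cos x = 0 then 2 * x else h x)" for x
  have r: "r > 0"
    using assms by (simp add: r_def)
  have h_eq: "h x = 2 * arctan (r * tan (x - pi * of_int k)) + 2 * pi * of_int k"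
    if "pi * (of_int k - 1 / 2) \<le> x" "x < pi * (of_int k + 1 / 2)" for x and k :: int
  proof -
    have "\<lfloor>x / pi + 1 / 2\<rfloor> = k"
      using that by (simp add: floor_eq_iff field_simps)
    moreover have "tan (x - pi * of_int k) = tan x"
      using tan_periodic_int[of "x" "- k"] by (simp add: mult.commute)
    ultimately show ?thesis by (simp add: h_def)
  qed
  have h_left: "(h \<longlongrightarrow> 2 * u) (at_left u)" if u: "u = pi * (of_int k + 1 / 2)" for u and k :: int
  proof -
    have "filterlim (\<lambda>x. x - pi * of_int k) (at_left (pi / 2)) (at_left u)"
      unfolding filterlim_at
    proof
      show "\<forall>\<^sub>F x in at_left u. x - pi * of_int k \<in> {..<pi / 2} \<and> x - pi * of_int k \<noteq> pi / 2"
        by (auto simp: eventually_at_filter u algebra_simps)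
      have "((\<lambda>x. x - pi * of_int k) \<longlongrightarrow> u - pi * of_int k) (at_left u)"
        by (intro tendsto_intros)
      thus "((\<lambda>x. x - pi * of_int k) \<longlongrightarrow> pi / 2) (at_left u)"
        by (simp add: u algebra_simps)
    qed
    hence "filterlim (\<lambda>x. tan (x - pi * of_int k)) at_top (at_left u)"
      by (rule filterlim_compose[OF filterlim_tan_at_left])
    hence "filterlim (\<lambda>x. r * tan (x - pi * of_int k)) at_top (at_left u)"
      using r by (intro filterlim_tendsto_pos_mult_at_top[OF tendsto_const])
    hence "((\<lambda>x. arctan (r * tan (x - pi * of_int k))) \<longlongrightarrow> pi / 2) (at_left u)"
      by (rule filterlim_compose[OF tendsto_arctan_at_top])
    hence "((\<lambda>x. 2 * arctan (r * tan (x - pi * of_int k)) + 2 * pi * of_int k)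
        \<longlongrightarrow> 2 * (pi / 2) + 2 * pi * of_int k) (at_left u)"
      by (intro tendsto_intros)
    moreover have "\<forall>\<^sub>F x in at_left u. x \<in> {u - pi<..<u}"
      by (rule eventually_at_left_real) simp
    hence "\<forall>\<^sub>F x in at_left u. h x = 2 * arctan (r * tan (x - pi * of_int k)) + 2 * pi * of_int k"
      by eventually_elim (rule h_eq, auto simp: u algebra_simps)
    ultimately show ?thesis
      by (simp add: tendsto_cong u algebra_simps)
  qed
  have h_right: "(h \<longlongrightarrow> 2 * u) (at_right u)" if u: "u = pi * (of_int k - 1 / 2)" for u and k :: int
  proof -
    have "filterlim (\<lambda>x. x - pi * of_int k) (at_right (- (pi / 2))) (at_right u)"
      unfolding filterlim_at
    proof
      show "\<forall>\<^sub>F x in at_right u. x - pi * of_int k \<in> {- (pi / 2)<..} \<and> x - pi * of_int k \<noteq> - (pi / 2)"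
        by (auto simp: eventually_at_filter u algebra_simps)
      have "((\<lambda>x. x - pi * of_int k) \<longlongrightarrow> u - pi * of_int k) (at_right u)"
        by (intro tendsto_intros)
      thus "((\<lambda>x. x - pi * of_int k) \<longlongrightarrow> - (pi / 2)) (at_right u)"
        by (simp add: u algebra_simps)
    qed
    hence "filterlim (\<lambda>x. tan (x - pi * of_int k)) at_bot (at_right u)"
      by (rule filterlim_compose[OF filterlim_tan_at_right])
    hence "filterlim (\<lambda>x. r * tan (x - pi * of_int k)) at_bot (at_right u)"
      using r by (intro filterlim_tendsto_pos_mult_at_bot[OF tendsto_const])
    hence "((\<lambda>x. arctan (r * tan (x - pi * of_int k))) \<longlongrightarrow> - (pi / 2)) (at_right u)"
      by (rule filterlim_compose[OF tendsto_arctan_at_bot])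
    hence "((\<lambda>x. 2 * arctan (r * tan (x - pi * of_int k)) + 2 * pi * of_int k)
        \<longlongrightarrow> 2 * (- (pi / 2)) + 2 * pi * of_int k) (at_right u)"
      by (intro tendsto_intros)
    moreover have "\<forall>\<^sub>F x in at_right u. x \<in> {u<..<u + pi}"
      by (rule eventually_at_right_real) simp
    hence "\<forall>\<^sub>F x in at_right u. h x = 2 * arctan (r * tan (x - pi * of_int k)) + 2 * pi * of_int k"
      by eventually_elim (rule h_eq, auto simp: u algebra_simps)
    ultimately show ?thesis
      by (simp add: tendsto_cong u algebra_simps)
  qed
  have "isCont g u" for u
  proof -
    define k where "k = \<lfloor>u / pi + 1 / 2\<rfloor>"
    have k: "pi * (of_int k - 1 / 2) \<le> u" "u < pi * (of_int k + 1 / 2)"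
      using floor_correct[of "u / pi + 1 / 2"] unfolding k_def[symmetric] by (auto simp: field_simps)
    have cos0: "cos x \<noteq> 0" if "pi * (of_int i - 1 / 2) < x" "x < pi * (of_int i + 1 / 2)" for x and i :: int
    proof -
      have "cos (x - pi * of_int i) > 0"
        using that by (intro cos_gt_zero_pi) (auto simp: algebra_simps)
      moreover have "cos x = cos (x - pi * of_int i) * cos (pi * of_int i)"
        using cos_add[of "x - pi * of_int i" "pi * of_int i"] by (simp add: sin_times_pi_eq_0)
      moreover have "cos (pi * of_int i) \<noteq> 0"
        using sin_cos_squared_add[of "pi * of_int i"] by (auto simp: sin_times_pi_eq_0)
      ultimately show ?thesis by simp
    qed
    show ?thesis
    proof (cases "u = pi * (of_int k - 1 / 2)")
      case True
      have "cos u = 0"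
      proof -
        have "cos u = cos (pi * of_int k - pi / 2)" by (simp add: True algebra_simps)
        thus ?thesis by (simp add: cos_diff sin_times_pi_eq_0)
      qed
      hence gu: "g u = 2 * u" by (simp add: g_def)
      have "\<forall>\<^sub>F x in at_left u. x \<in> {u - pi<..<u}"
        by (rule eventually_at_left_real) simp
      hence L: "\<forall>\<^sub>F x in at_left u. g x = h x"
      proof eventually_elim
        case (elim x)
        have "cos x \<noteq> 0"
          by (rule cos0[of "k - 1"]) (use elim True in \<open>auto simp: algebra_simps\<close>)
        thus ?case by (simp add: g_def)
      qed
      have "\<forall>\<^sub>F x in at_right u. x \<in> {u<..<u + pi}"
        by (rule eventually_at_right_real) simp
      hence R: "\<forall>\<^sub>F x in at_right u. g x = h x"
      proof eventually_elim
        case (elim x)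
        have "cos x \<noteq> 0"
          by (rule cos0[of k]) (use elim True in \<open>auto simp: algebra_simps\<close>)
        thus ?case by (simp add: g_def)
      qed
      have "(g \<longlongrightarrow> 2 * u) (at_left u)"
        unfolding tendsto_cong[OF L] by (rule h_left[of _ "k - 1"]) (simp add: True algebra_simps)
      moreover have "(g \<longlongrightarrow> 2 * u) (at_right u)"
        unfolding tendsto_cong[OF R] by (rule h_right[of _ k]) (simp add: True)
      ultimately show ?thesis
        unfolding isCont_def gu by (rule filterlim_split_at)
    next
      case False
      define G where "G x = 2 * arctan (r * tan (x - pi * of_int k)) + 2 * pi * of_int k" for x
      have u: "u \<in> {pi * (of_int k - 1 / 2)<..<pi * (of_int k + 1 / 2)}"
        using k False by auto
      have "\<forall>\<^sub>F x in nhds u. x \<in> {pi * (of_int k - 1 / 2)<..<pi * (of_int k + 1 / 2)}"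
        by (rule eventually_nhds_in_open) (use u in auto)
      hence "\<forall>\<^sub>F x in nhds u. g x = G x"
      proof eventually_elim
        case (elim x)
        have "cos x \<noteq> 0"
          by (rule cos0[of k]) (use elim in auto)
        moreover have "h x = G x"
          unfolding G_def by (rule h_eq) (use elim in auto)
        ultimately show ?case by (simp add: g_def)
      qed
      moreover have "cos (u - pi * of_int k) > 0"
        using u by (intro cos_gt_zero_pi) (auto simp: algebra_simps)
      hence "isCont G u"
        unfolding G_def by (intro continuous_intros) auto
      ultimately show ?thesis
        by (simp add: isCont_cong)
    qed
  qed
  hence g: "isCont g (pi * \<xi> + A)" .
  have "isCont (\<lambda>\<xi>. pi * \<xi> + A) \<xi>"
    by (intro continuous_intros)
  from isCont_o2[OF this g] have "isCont (\<lambda>\<xi>. g (pi * \<xi> + A) - \<alpha>) \<xi>"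
    by (rule isCont_diff) simp
  moreover have "phi \<alpha> \<beta> A = (\<lambda>\<xi>. g (pi * \<xi> + A) - \<alpha>)"
    by (auto simp: fun_eq_iff phi_def g_def h_def r_def Let_def)
  ultimately show ?thesis by simp
qed

text \<open>Points of \<open>\<bbbT>\<^sup>N\<close> are functions on \<open>{1..N}\<close>, extended by \<open>undefined\<close>.\<close>

definition Wu_theta :: "nat \<Rightarrow> circle \<Rightarrow> real \<Rightarrow> (nat \<Rightarrow> circle) set" where
  "Wu_theta N q bt =
     {\<lambda>i\<in>{1..N}. to_circle (phi_i N i \<alpha> \<beta> A) | \<alpha> \<beta> A.
        \<beta> \<in> {0..bt} \<and> \<alpha> \<in> {-pi..pi} \<and> A \<in> {-(pi/2)..pi/2} \<and>
        to_circle ((\<Sum>i=1..N. phi_i N i \<alpha> \<beta> A) / real N) = q}"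

section \<open>The Ott--Antonsen manifold\<close>

definition oa_density :: "real \<Rightarrow> real \<Rightarrow> real \<Rightarrow> real" where
  "oa_density \<alpha> \<beta> \<theta> = 1 / (2 * pi) * ((1 - \<beta>\<^sup>2) / (1 - 2 * \<beta> * cos (\<alpha> + \<theta>) + \<beta>\<^sup>2))"

text \<open>The measure \<open>f d\<theta>\<close> on the circle, pushed forward from a fundamental interval.\<close>

definition oa_measure :: "real \<Rightarrow> real \<Rightarrow> circle measure" where
  "oa_measure \<alpha> \<beta> =
     distr (density (restrict_space lborel {-pi..<pi}) (\<lambda>\<theta>. ennreal (oa_density \<alpha> \<beta> \<theta>))) borel to_circle"

definition M_OA :: "real \<Rightarrow> circle measure set" where
  "M_OA bt = {oa_measure \<alpha> \<beta> | \<alpha> \<beta>. \<beta> \<in> {0..bt} \<and> \<alpha> \<in> {-pi..pi}}"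

section \<open>The continuum-limit manifold\<close>

text \<open>For \<open>x < 0\<close> the interval integral is the signed one.  For \<open>0 \<le> \<beta> < 1\<close> the function is an
  increasing bijection of the line, so that \<open>inv\<close> below is its inverse.\<close>

definition F_OA :: "real \<Rightarrow> real \<Rightarrow> real \<Rightarrow> real" where
  "F_OA \<alpha> \<beta> x = (LBINT \<theta>=0..x. oa_density \<alpha> \<beta> \<theta>)"

definition C_OA :: "real \<Rightarrow> real \<Rightarrow> real" where
  "C_OA \<alpha> \<beta> = - (1 / pi) * arctan (\<beta> * sin \<alpha> / (1 - \<beta> * cos \<alpha>))"

text \<open>
  Functions on \<open>[0,1]\<close> are extended by \<open>undefined\<close>.  Here \<open>r\<close> is a real representative of \<open>q\<close>;
  replacing it by \<open>r + 2 \<pi>\<close> shifts the value of the inverse by \<open>2 \<pi>\<close>, so that all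
  representatives give the same function.
\<close>

definition Wu_y :: "circle \<Rightarrow> real \<Rightarrow> (real \<Rightarrow> circle) set" where
  "Wu_y q bt =
     {\<lambda>\<xi>\<in>{0..1}. to_circle (inv (F_OA \<alpha> \<beta>) (\<xi> + C_OA \<alpha> \<beta> + r / (2 * pi))) | \<alpha> \<beta> r.
        \<beta> \<in> {0..bt} \<and> \<alpha> \<in> {-pi..pi} \<and> to_circle r = q}"

section \<open>Lifts\<close>

definition empirical_measure :: "nat \<Rightarrow> (nat \<Rightarrow> circle) \<Rightarrow> circle measure" where
  "empirical_measure N x =
     measure_of UNIV (sets borel) (\<lambda>S. (\<Sum>i=1..N. emeasure (return borel (x i)) S) / of_nat N)"

definition step_lift :: "nat \<Rightarrow> (nat \<Rightarrow> circle) \<Rightarrow> real \<Rightarrow> circle" where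
  "step_lift N x = (\<lambda>\<xi>\<in>{0..1}. x (min N (nat \<lfloor>real N * \<xi>\<rfloor> + 1)))"

lemma sets_empirical_measure [simp, measurable_cong]: "sets (empirical_measure N x) = sets borel"
  unfolding empirical_measure_def
  by (metis sets.sets_measure_of_eq space_borel)

lemma emeasure_empirical_measure:
  assumes "S \<in> sets borel"
  shows "emeasure (empirical_measure N x) S = (\<Sum>i=1..N. emeasure (return borel (x i)) S) / of_nat N"
proof (rule emeasure_measure_of[OF empirical_measure_def])
  show "countably_additive (sets (empirical_measure N x))
      (\<lambda>S. (\<Sum>i=1..N. emeasure (return borel (x i)) S) / of_nat N)"
    unfolding countably_additive_def
  proof safe
    fix D :: "nat \<Rightarrow> circle set"
    assume D: "range D \<subseteq> sets (empirical_measure N x)" "disjoint_family D"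
    have "(\<Sum>n. (\<Sum>i=1..N. emeasure (return borel (x i)) (D n)) / of_nat N) =
        (\<Sum>i=1..N. \<Sum>n. emeasure (return borel (x i)) (D n)) / of_nat N"
      by (simp add: divide_ennreal_def suminf_sum)
    also have "\<dots> = (\<Sum>i=1..N. emeasure (return borel (x i)) (\<Union> (range D))) / of_nat N"
      using D by (subst suminf_emeasure) auto
    finally show "(\<Sum>n. (\<Sum>i=1..N. emeasure (return borel (x i)) (D n)) / of_nat N) =
        (\<Sum>i=1..N. emeasure (return borel (x i)) (\<Union> (range D))) / of_nat N" .
  qed
qed (use assms in \<open>auto simp: positive_def\<close>)

lemma step_lift_eq:
  assumes "i \<in> {1..N}" "\<xi> \<in> {(real i - 1) / real N..<real i / real N}"
  shows "step_lift N x \<xi> = x i"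
proof -
  have N: "real N > 0" and i: "real i \<ge> 1" "real i \<le> real N"
    using assms by auto
  have b: "real i - 1 \<le> real N * \<xi>" "real N * \<xi> < real i"
    using assms N by (auto simp: field_simps)
  hence "\<lfloor>real N * \<xi>\<rfloor> = int i - 1"
    by linarith
  moreover have "\<xi> \<le> 1" "0 \<le> \<xi>"
  proof -
    have "real N * \<xi> \<le> real N * 1" "real N * 0 \<le> real N * \<xi>"
      using b i by linarith+
    thus "\<xi> \<le> 1" "0 \<le> \<xi>"
      using N by (simp_all only: mult_le_cancel_left_pos)
  qed
  moreover have "min N (nat (int i - 1) + 1) = i"
    using assms(1) by auto
  ultimately show ?thesis
    by (simp add: step_lift_def)
qed

lemma step_lift_1: "N \<ge> 1 \<Longrightarrow> step_lift N x 1 = x N"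
  by (simp add: step_lift_def)

end

(*
  The function 2 arctan ((1 - b)/(1 + b) tan (t/2)), continued along the line, is the globally smooth
  lift g_b t = t - 2 arctan (b sin t / (1 + b cos t)) of a Moebius transformation of the circle.  Its
  inverse is g_{-b}, whose derivative is 2 pi times the Ott-Antonsen density.  Hence the finite and the
  continuum profiles are samples of the same family of functions g_b (2 pi xi + const) - alpha, and
  the density is the law of such a function for uniform xi.

  The constant is 2 A in the finite case and alpha + q - pi in the continuum.  The mean condition
  makes them agree up to the mean of g_b t - t over N equispaced points, which is O(1/N); as g_b is
  Lipschitz uniformly for b <= bt, matched profiles are uniformly O(1/N) close.  Conversely a
  suitable A exists by the intermediate value theorem, because the mean increases by 2 pi as A runs
  through a period.  Uniform closeness bounds every Wasserstein distance through the
  coupling by a common uniform variable xi.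
*)

theory Submission
  imports Defs
begin

section \<open>Lifted Moebius transformations of the circle\<close>

text \<open>As \<open>1 + \<beta> cos t\<close> is positive for |\<beta>| < 1, the arctan is the
  argument of 1 + \<beta> e^(it). So this is a continuous lift of z -> (z + \<beta>) / (1 + \<beta>
  z) on the unit circle, with no case distinction at the poles of the tangent.\<close>

definition moebius_lift :: "real \<Rightarrow> real \<Rightarrow> real" where
  "moebius_lift \<beta> t = t - 2 * arctan (\<beta> * sin t / (1 + \<beta> * cos t))"

text \<open>The Poisson kernel with parameter -\<beta>, normalised to have mean 1 over a
  period.\<close>

definition moebius_deriv :: "real \<Rightarrow> real \<Rightarrow> real" where
  "moebius_deriv \<beta> t = (1 - \<beta>\<^sup>2) / (1 + 2 * \<beta> * cos t + \<beta>\<^sup>2)"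

section \<open>Bounds for the Poisson kernel\<close>

lemma one_plus_mult_cos_pos:
  fixes \<beta> t :: real
  assumes "\<bar>\<beta>\<bar> < 1"
  shows "1 + \<beta> * cos t > 0"
proof -
  have "\<bar>\<beta> * cos t\<bar> \<le> \<bar>\<beta>\<bar> * 1"
    unfolding abs_mult by (intro mult_left_mono) auto
  with assms show ?thesis by linarith
qed

text \<open>The right-hand side is the squared modulus of 1 + \<beta> e^(it).\<close>

lemma poisson_denominator_ge:
  fixes \<beta> t :: real
  shows "(1 - \<bar>\<beta>\<bar>)\<^sup>2 \<le> 1 + 2 * \<beta> * cos t + \<beta>\<^sup>2"
proof -
  have "\<bar>\<beta> * cos t\<bar> \<le> \<bar>\<beta>\<bar> * 1"
    unfolding abs_mult by (intro mult_left_mono) auto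
  thus ?thesis
    by (simp add: power2_diff abs_le_iff)
qed

lemma poisson_denominator_pos:
  fixes \<beta> t :: real
  assumes "\<bar>\<beta>\<bar> < 1"
  shows "1 + 2 * \<beta> * cos t + \<beta>\<^sup>2 > 0"
proof -
  have "0 < (1 - \<bar>\<beta>\<bar>)\<^sup>2"
    using assms by simp
  with poisson_denominator_ge[of \<beta> t] show ?thesis by linarith
qed

lemma moebius_deriv_nonneg: "\<bar>\<beta>\<bar> < 1 \<Longrightarrow> 0 \<le> moebius_deriv \<beta> t"
  unfolding moebius_deriv_def
  using poisson_denominator_pos[of \<beta> t] by (simp add: abs_square_le_1)

text \<open>Replacing the denominator by its lower bound leaves (1 + |\<beta>|) / (1 - |\<beta>|),
  which increases with |\<beta>|. Bounding by \<open>b\<close> makes the constant uniform over the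
  whole family.\<close>

lemma moebius_deriv_le:
  assumes "\<bar>\<beta>\<bar> \<le> b" "b < 1"
  shows "moebius_deriv \<beta> t \<le> (1 + b) / (1 - b)"
proof -
  have "0 < (1 - \<bar>\<beta>\<bar>)\<^sup>2" "0 \<le> 1 - \<beta>\<^sup>2"
    using assms by (simp_all add: abs_square_le_1)
  hence "moebius_deriv \<beta> t \<le> (1 - \<beta>\<^sup>2) / (1 - \<bar>\<beta>\<bar>)\<^sup>2"
    unfolding moebius_deriv_def
    by (intro divide_left_mono poisson_denominator_ge mult_pos_pos poisson_denominator_pos)
       (use assms in auto)
  also have "1 - \<beta>\<^sup>2 = (1 - \<bar>\<beta>\<bar>) * (1 + \<bar>\<beta>\<bar>)"
    by (simp add: algebra_simps power2_eq_square)
  also have "\<dots> / (1 - \<bar>\<beta>\<bar>)\<^sup>2 = (1 + \<bar>\<beta>\<bar>) / (1 - \<bar>\<beta>\<bar>)"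
    using assms by (simp add: power2_eq_square)
  also have "\<dots> \<le> (1 + b) / (1 - b)"
    using assms by (intro frac_le) auto
  finally show ?thesis .
qed

lemma continuous_moebius_deriv: "\<bar>\<beta>\<bar> < 1 \<Longrightarrow> continuous_on S (moebius_deriv \<beta>)"
  unfolding moebius_deriv_def
  using poisson_denominator_pos[of \<beta>] by (intro continuous_intros) (auto simp: less_imp_neq[symmetric])

section \<open>Differentiability and the uniform Lipschitz bound\<close>

lemma has_real_derivative_moebius_lift:
  assumes "\<bar>\<beta>\<bar> < 1"
  shows "(moebius_lift \<beta> has_real_derivative moebius_deriv \<beta> t) (at t within S)"
proof -
  have pos: "1 + \<beta> * cos t > 0" "1 + 2 * \<beta> * cos t + \<beta>\<^sup>2 > 0"
    using one_plus_mult_cos_pos poisson_denominator_pos assms by auto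
  \<comment> \<open>With sine and cosine abstracted, only polynomial identities modulo s^2 + c^2 = 1
    remain.\<close>
  define c s where "c = cos t" and "s = sin t"
  have s2: "s\<^sup>2 = 1 - c\<^sup>2"
    unfolding s_def c_def by (simp add: sin_squared_eq)
  have nz: "1 + \<beta> * c \<noteq> 0" "1 + 2 * \<beta> * c + \<beta>\<^sup>2 \<noteq> 0"
    using pos unfolding c_def by auto
  have sq: "1 + (\<beta> * s / (1 + \<beta> * c))\<^sup>2 = (1 + 2 * \<beta> * c + \<beta>\<^sup>2) / (1 + \<beta> * c)\<^sup>2"
    using nz by (simp add: field_simps power_mult_distrib power_divide s2)
       (simp add: algebra_simps power2_eq_square)
  \<comment> \<open>The numerator from the quotient rule. After cancelling (1 + \<beta> c)^2 the
    derivative is 1 - 2 (\<beta> c + \<beta>^2) / (1 + 2 \<beta> c + \<beta>^2).\<close>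
  have num: "\<beta> * c * (1 + \<beta> * c) - \<beta> * s * (\<beta> * - s) = \<beta> * c + \<beta>\<^sup>2"
  proof -
    have "\<beta> * c * (1 + \<beta> * c) - \<beta> * s * (\<beta> * - s) = \<beta> * c + \<beta>\<^sup>2 * c\<^sup>2 + \<beta>\<^sup>2 * s\<^sup>2"
      by (simp add: algebra_simps power2_eq_square)
    thus ?thesis by (simp add: s2 algebra_simps)
  qed
  have "(moebius_lift \<beta> has_real_derivative
      1 - 2 * ((\<beta> * c * (1 + \<beta> * c) - \<beta> * s * (\<beta> * - s)) / ((1 + \<beta> * c) * (1 + \<beta> * c))
        / (1 + (\<beta> * s / (1 + \<beta> * c))\<^sup>2))) (at t within S)"
    unfolding moebius_lift_def[abs_def] c_def s_def using pos
    by (auto intro!: derivative_eq_intros simp: field_simps)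
  also have "1 - 2 * ((\<beta> * c * (1 + \<beta> * c) - \<beta> * s * (\<beta> * - s)) / ((1 + \<beta> * c) * (1 + \<beta> * c))
        / (1 + (\<beta> * s / (1 + \<beta> * c))\<^sup>2)) = moebius_deriv \<beta> t"
    unfolding num sq moebius_deriv_def c_def[symmetric] using nz
    by (simp add: power2_eq_square) (simp add: field_simps)
  finally show ?thesis .
qed

lemma continuous_moebius_lift: "\<bar>\<beta>\<bar> < 1 \<Longrightarrow> continuous_on S (moebius_lift \<beta>)"
  by (meson DERIV_continuous_on has_real_derivative_moebius_lift)

lemma borel_measurable_moebius_lift: "\<bar>\<beta>\<bar> < 1 \<Longrightarrow> moebius_lift \<beta> \<in> borel_measurable borel"
  by (intro borel_measurable_continuous_onI continuous_moebius_lift)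

lemma moebius_lift_lipschitz:
  assumes "\<bar>\<beta>\<bar> \<le> b" "b < 1"
  shows "\<bar>moebius_lift \<beta> t - moebius_lift \<beta> s\<bar> \<le> (1 + b) / (1 - b) * \<bar>t - s\<bar>"
proof -
  have "norm (moebius_lift \<beta> t - moebius_lift \<beta> s) \<le> (1 + b) / (1 - b) * norm (t - s)"
  proof (rule field_differentiable_bound[of UNIV _ "moebius_deriv \<beta>"])
    show "norm (moebius_deriv \<beta> z) \<le> (1 + b) / (1 - b)" for z
      using moebius_deriv_le[OF assms] moebius_deriv_nonneg[of \<beta> z] assms by simp
  qed (use assms in \<open>auto intro!: has_real_derivative_moebius_lift\<close>)
  thus ?thesis by simp
qed

section \<open>Symmetries, the half-angle form and the inverse\<close>

lemma moebius_lift_minus [simp]: "moebius_lift \<beta> (- t) = - moebius_lift \<beta> t"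
  by (simp add: moebius_lift_def arctan_minus)

lemma moebius_lift_add_2pi_int: "moebius_lift \<beta> (t + 2 * pi * of_int k) = moebius_lift \<beta> t + 2 * pi * of_int k"
proof -
  have "sin (t + 2 * pi * of_int k) = sin t" "cos (t + 2 * pi * of_int k) = cos t"
    by (simp_all add: sin_add cos_add)
  thus ?thesis by (simp add: moebius_lift_def)
qed

lemma moebius_lift_pi [simp]: "moebius_lift \<beta> pi = pi"
  by (simp add: moebius_lift_def)

text \<open>Both sides vanish at 0 and have the same derivative on the open interval between two
  poles of the tangent.\<close>

lemma moebius_lift_eq_arctan:
  assumes \<beta>: "\<bar>\<beta>\<bar> < 1" and v: "\<bar>v\<bar> < pi / 2"
  shows "moebius_lift \<beta> (2 * v) = 2 * arctan ((1 - \<beta>) / (1 + \<beta>) * tan v)"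
proof -
  define r where "r = (1 - \<beta>) / (1 + \<beta>)"
  have "((\<lambda>v. moebius_lift \<beta> (2 * v) - 2 * arctan (r * tan v)) has_field_derivative 0)
      (at v within {- (pi / 2)<..<pi / 2})" if "v \<in> {- (pi / 2)<..<pi / 2}" for v
  proof -
    have c0: "cos v > 0"
      using that by (intro cos_gt_zero_pi) auto
    \<comment> \<open>Both cos (2 v) and tan^2 v are rational in cos^2 v, so comparing the
      derivatives becomes algebra.\<close>
    define c where "c = (cos v)\<^sup>2"
    have c: "c > 0" "cos (2 * v) = 2 * c - 1" "(tan v)\<^sup>2 = (1 - c) / c"
      using c0 by (auto simp: c_def cos_double_cos tan_def power_divide sin_squared_eq)
    have \<beta>1: "1 + \<beta> > 0"
      using \<beta> by auto
    have pos: "1 + 2 * \<beta> * (2 * c - 1) + \<beta>\<^sup>2 > 0"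
      using poisson_denominator_pos[OF \<beta>, of "2 * v"] c by simp
    have "1 + (r * tan v)\<^sup>2 = 1 + (1 - \<beta>)\<^sup>2 * (1 - c) / ((1 + \<beta>)\<^sup>2 * c)"
      by (simp only: power_mult_distrib c(3) r_def power_divide times_divide_times_eq)
    also have "\<dots> = ((1 + \<beta>)\<^sup>2 * c + (1 - \<beta>)\<^sup>2 * (1 - c)) / ((1 + \<beta>)\<^sup>2 * c)"
      using c(1) \<beta>1 by (simp add: add_divide_distrib)
    also have "(1 + \<beta>)\<^sup>2 * c + (1 - \<beta>)\<^sup>2 * (1 - c) = 1 + 2 * \<beta> * (2 * c - 1) + \<beta>\<^sup>2"
      by (simp add: algebra_simps power2_eq_square)
    finally have sq: "1 + (r * tan v)\<^sup>2 = (1 + 2 * \<beta> * (2 * c - 1) + \<beta>\<^sup>2) / ((1 + \<beta>)\<^sup>2 * c)" .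
    have eq: "moebius_deriv \<beta> (2 * v) * 2 - 2 * (r * inverse c / (1 + (r * tan v)\<^sup>2)) = 0"
    proof -
      define d where "d = 1 + \<beta>"
      define E where "E = 1 + 2 * \<beta> * (2 * c - 1) + \<beta>\<^sup>2"
      have "r * inverse c / (1 + (r * tan v)\<^sup>2) = (1 - \<beta>) * (1 + \<beta>) / E"
        unfolding sq E_def[symmetric] unfolding r_def power2_eq_square d_def[symmetric]
        using c(1) \<beta>1[folded d_def] by (simp add: divide_inverse) (simp add: field_simps)
      also have "(1 - \<beta>) * (1 + \<beta>) = 1 - \<beta>\<^sup>2"
        by (simp add: algebra_simps power2_eq_square)
      also have "(1 - \<beta>\<^sup>2) / E = moebius_deriv \<beta> (2 * v)"
        unfolding moebius_deriv_def c(2) E_def ..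
      finally show ?thesis by simp
    qed
    have d1: "((\<lambda>v. moebius_lift \<beta> (2 * v)) has_field_derivative moebius_deriv \<beta> (2 * v) * 2)
        (at v within {- (pi / 2)<..<pi / 2})"
      by (rule DERIV_chain2[OF has_real_derivative_moebius_lift[OF \<beta>]])
         (auto intro!: derivative_eq_intros)
    have "((\<lambda>v. 2 * arctan (r * tan v)) has_field_derivative
        2 * (inverse (1 + (r * tan v)\<^sup>2) * (r * inverse c))) (at v within {- (pi / 2)<..<pi / 2})"
      unfolding c_def using c0
      by (intro DERIV_cmult DERIV_chain2[OF DERIV_arctan]
          DERIV_subset[OF DERIV_tan]) auto
    hence d2: "((\<lambda>v. 2 * arctan (r * tan v)) has_field_derivative
        2 * (r * inverse c / (1 + (r * tan v)\<^sup>2))) (at v within {- (pi / 2)<..<pi / 2})"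
      by (simp only: divide_inverse mult.commute[of "r * inverse c"])
    show ?thesis
      using DERIV_diff[OF d1 d2] unfolding eq .
  qed
  hence "\<exists>C. \<forall>v\<in>{- (pi / 2)<..<pi / 2}. moebius_lift \<beta> (2 * v) - 2 * arctan (r * tan v) = C"
    by (rule has_field_derivative_zero_constant[OF convex_real_interval(8)])
  then obtain C where C: "\<forall>v\<in>{- (pi / 2)<..<pi / 2}. moebius_lift \<beta> (2 * v) - 2 * arctan (r * tan v) = C" ..
  have "C = 0"
    using bspec[OF C, of 0] by (simp add: moebius_lift_def)
  thus ?thesis
    using bspec[OF C, of v] v unfolding abs_less_iff by (simp add: r_def)
qed

text \<open>In half-angle form the lift multiplies the tangent by (1 - \<beta>) / (1 + \<beta>), and
  replacing \<beta> by -\<beta> inverts this factor. Periodicity reduces every argument to this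
  case.\<close>

lemma moebius_lift_inverse:
  assumes \<beta>: "\<bar>\<beta>\<bar> < 1"
  shows "moebius_lift (- \<beta>) (moebius_lift \<beta> t) = t"
proof -
  \<comment> \<open>Removing \<open>k\<close> full turns brings the argument \<open>2 * v\<close>
    into [-pi, pi).\<close>
  define k where "k = \<lfloor>(t + pi) / (2 * pi)\<rfloor>"
  define v where "v = (t - 2 * pi * of_int k) / 2"
  have t: "t = 2 * v + 2 * pi * of_int k"
    by (simp add: v_def field_simps)
  have "of_int k \<le> (t + pi) / (2 * pi)" "(t + pi) / (2 * pi) < of_int k + 1"
    unfolding k_def by linarith+
  hence v: "- (pi / 2) \<le> v" "v < pi / 2"
    by (auto simp: v_def field_simps)
  have "moebius_lift (- \<beta>) (moebius_lift \<beta> (2 * v)) = 2 * v"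
  proof (cases "v = - (pi / 2)")
    case True
    have "2 * v = - pi" by (simp add: True)
    thus ?thesis by (simp only: moebius_lift_minus moebius_lift_pi)
  next
    case False
    define w where "w = arctan ((1 - \<beta>) / (1 + \<beta>) * tan v)"
    have "moebius_lift \<beta> (2 * v) = 2 * w"
      unfolding w_def by (rule moebius_lift_eq_arctan) (use \<beta> v False in auto)
    moreover have "\<bar>w\<bar> < pi / 2"
      using arctan_bounded[of "(1 - \<beta>) / (1 + \<beta>) * tan v"] unfolding w_def by linarith
    hence "moebius_lift (- \<beta>) (2 * w) = 2 * arctan ((1 + \<beta>) / (1 - \<beta>) * tan w)"
      using moebius_lift_eq_arctan[of "- \<beta>" w] \<beta> by simp
    moreover have "(1 + \<beta>) / (1 - \<beta>) * tan w = tan v"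
      using \<beta> by (simp add: w_def tan_arctan)
    ultimately show ?thesis
      using v False by (simp add: arctan_tan)
  qed
  thus ?thesis
    unfolding t moebius_lift_add_2pi_int by simp
qed

text \<open>The integer \<open>k\<close> in \<open>phi\<close> counts the turns removed to reach the
  principal branch, where the half-angle form applies; adding them back is the quasi-periodicity of
  the lift.\<close>

lemma phi_eq_moebius_lift:
  assumes \<beta>: "\<bar>\<beta>\<bar> < 1"
  shows "phi \<alpha> \<beta> A \<xi> = moebius_lift \<beta> (2 * pi * \<xi> + 2 * A) - \<alpha>"
proof -
  define u where "u = pi * \<xi> + A"
  define k where "k = \<lfloor>u / pi + 1 / 2\<rfloor>"
  define v where "v = u - pi * of_int k"
  have "of_int k \<le> u / pi + 1 / 2" "u / pi + 1 / 2 < of_int k + 1"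
    unfolding k_def by linarith+
  hence v: "- (pi / 2) \<le> v" "v < pi / 2"
    by (auto simp: v_def field_simps)
  have eq: "moebius_lift \<beta> (2 * pi * \<xi> + 2 * A) = moebius_lift \<beta> (2 * v) + 2 * pi * of_int k"
    unfolding moebius_lift_add_2pi_int[symmetric] by (simp add: v_def u_def algebra_simps)
  have cosu: "cos u = cos v * cos (pi * of_int k)"
    using cos_add[of v "pi * of_int k"] by (simp add: v_def sin_times_pi_eq_0)
  have tanu: "tan u = tan v"
    using tan_periodic_int[of v k] by (simp add: v_def mult.commute)
  have cosk: "cos (pi * of_int k) \<noteq> 0"
    using sin_cos_squared_add[of "pi * of_int k"] by (auto simp: sin_times_pi_eq_0)
  show ?thesis
  proof (cases "v = - (pi / 2)")
    \<comment> \<open>A pole of the tangent: the value \<open>2 * u - \<alpha>\<close> prescribed by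
      \<open>phi\<close> agrees with the lift because the lift fixes -pi.\<close>
    case True
    hence "2 * v = - pi" by simp
    hence "moebius_lift \<beta> (2 * v) = 2 * v"
      by (simp only: moebius_lift_minus moebius_lift_pi)
    moreover have "cos u = 0"
      by (simp add: cosu True)
    moreover have "2 * u = 2 * v + 2 * pi * of_int k"
      by (simp add: v_def)
    ultimately show ?thesis
      by (simp add: phi_def u_def[symmetric] eq)
  next
    case False
    have "cos v > 0"
      using v False by (intro cos_gt_zero_pi) auto
    hence "cos u \<noteq> 0"
      using cosk by (simp add: cosu)
    moreover have "moebius_lift \<beta> (2 * v) = 2 * arctan ((1 - \<beta>) / (1 + \<beta>) * tan v)"
      by (rule moebius_lift_eq_arctan) (use \<beta> v False in auto)
    ultimately show ?thesis
      by (simp add: phi_def Let_def u_def[symmetric] k_def[symmetric] eq tanu)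
  qed
qed

section \<open>The continuum-limit manifold\<close>

lemma oa_density_eq: "oa_density \<alpha> \<beta> x = moebius_deriv (- \<beta>) (x + \<alpha>) / (2 * pi)"
  by (simp add: oa_density_def moebius_deriv_def add.commute)

text \<open>By \<open>oa_density_eq\<close> the density has the shifted lift for -\<beta>, divided
  by 2 pi, as a primitive; the second term enforces F(0) = 0.\<close>

lemma F_OA_eq:
  assumes \<beta>: "\<bar>\<beta>\<bar> < 1"
  shows "F_OA \<alpha> \<beta> x = (moebius_lift (- \<beta>) (x + \<alpha>) - moebius_lift (- \<beta>) \<alpha>) / (2 * pi)"
proof -
  have \<beta>': "\<bar>- \<beta>\<bar> < 1" using \<beta> by simp
  let ?G = "\<lambda>x. moebius_lift (- \<beta>) (x + \<alpha>) / (2 * pi)"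
  have "(LBINT \<theta>=ereal 0..ereal x. oa_density \<alpha> \<beta> \<theta>) = ?G x - ?G 0"
  proof (rule interval_integral_FTC_finite)
    show "continuous_on {min 0 x..max 0 x} (oa_density \<alpha> \<beta>)"
      unfolding oa_density_eq[abs_def]
      by (intro continuous_intros continuous_on_compose2[OF continuous_moebius_deriv[OF \<beta>', of UNIV]]) auto
    show "(?G has_vector_derivative oa_density \<alpha> \<beta> y) (at y within {min 0 x..max 0 x})" for y
      unfolding oa_density_eq has_real_derivative_iff_has_vector_derivative[symmetric]
      by (auto intro!: derivative_eq_intros DERIV_chain2[OF has_real_derivative_moebius_lift[OF \<beta>']])
  qed
  thus ?thesis
    by (simp add: F_OA_def zero_ereal_def diff_divide_distrib)
qed

lemma inv_F_OA_eq:
  assumes \<beta>: "\<bar>\<beta>\<bar> < 1"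
  shows "inv (F_OA \<alpha> \<beta>) (\<xi> + C_OA \<alpha> \<beta> + r / (2 * pi)) = moebius_lift \<beta> (2 * pi * \<xi> + \<alpha> + r) - \<alpha>"
proof (rule inv_f_eq)
  have \<beta>': "\<bar>- \<beta>\<bar> < 1" using \<beta> by simp
  have "inj (moebius_lift (- \<beta>))"
    by (rule inj_on_inverseI[of _ "moebius_lift \<beta>"]) (use moebius_lift_inverse[OF \<beta>'] in simp)
  thus "inj (F_OA \<alpha> \<beta>)"
    unfolding F_OA_eq[OF \<beta>, abs_def] inj_def by auto (metis add_right_cancel)
  \<comment> \<open>The constant \<open>C_OA\<close> is exactly what offsets the normalisation F(0)
    = 0, so that only the phase \<open>r\<close> remains.\<close>
  have "C_OA \<alpha> \<beta> = (\<alpha> - moebius_lift (- \<beta>) \<alpha>) / (2 * pi)"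
    by (simp add: C_OA_def moebius_lift_def arctan_minus field_simps)
  thus "F_OA \<alpha> \<beta> (moebius_lift \<beta> (2 * pi * \<xi> + \<alpha> + r) - \<alpha>) = \<xi> + C_OA \<alpha> \<beta> + r / (2 * pi)"
    by (simp add: F_OA_eq[OF \<beta>] moebius_lift_inverse[OF \<beta>] field_simps)
qed

lemma Wu_y_eq:
  assumes "bt < 1"
  shows "Wu_y q bt = {\<lambda>\<xi>\<in>{0..1}. to_circle (moebius_lift \<beta> (2 * pi * \<xi> + \<alpha> + r) - \<alpha>) | \<alpha> \<beta> r.
     \<beta> \<in> {0..bt} \<and> \<alpha> \<in> {-pi..pi} \<and> to_circle r = q}"
proof -
  have "(\<lambda>\<xi>\<in>{0..1}. to_circle (inv (F_OA \<alpha> \<beta>) (\<xi> + C_OA \<alpha> \<beta> + r / (2 * pi)))) =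
     (\<lambda>\<xi>\<in>{0..1}. to_circle (moebius_lift \<beta> (2 * pi * \<xi> + \<alpha> + r) - \<alpha>))" if "\<beta> \<in> {0..bt}" for \<alpha> \<beta> r
    using that assms by (subst inv_F_OA_eq) auto
  thus ?thesis
    unfolding Wu_y_def by (intro Collect_cong ex_cong1) metis
qed


section \<open>Means over equispaced points\<close>

text \<open>A shift by one index changes the sum by a telescoping difference whose two boundary
  terms are one period apart. Integer indices allow shifts in both directions.\<close>

lemma sum_periodic_shift:
  fixes f :: "int \<Rightarrow> 'a :: ab_group_add"
  assumes "\<And>i. f (i + int N) = f i"
  shows "(\<Sum>i=1..N. f (int i + k)) = (\<Sum>i=1..N. f (int i))"
proof -
  have step: "(\<Sum>i=1..N. f (int i + (k + 1))) = (\<Sum>i=1..N. f (int i + k))" for k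
  proof -
    have "(\<Sum>i=1..N. f (int (Suc i) + k) - f (int i + k)) = f (int (Suc N) + k) - f (int 1 + k)"
      by (rule sum_Suc_diff) simp
    also have "\<dots> = 0"
      using assms[of "1 + k"] by (simp add: algebra_simps)
    finally show ?thesis
      by (simp add: sum_subtractf algebra_simps)
  qed
  show ?thesis
  proof (induction k rule: int_induct[of _ 0])
    case (step1 i)
    thus ?case by (simp only: step)
  next
    case (step2 i)
    thus ?case using step[of "i - 1"] by simp
  qed simp
qed

definition moebius_mean :: "nat \<Rightarrow> real \<Rightarrow> real \<Rightarrow> real" where
  "moebius_mean N \<beta> a = (\<Sum>i=1..N. moebius_lift \<beta> (2 * pi * ((2 * real i - 1) / (2 * real N)) + a)) / real N"

lemma mean_phi_i:
  assumes "\<bar>\<beta>\<bar> < 1" "N \<ge> 1"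
  shows "(\<Sum>i=1..N. phi_i N i \<alpha> \<beta> A) / real N = moebius_mean N \<beta> (2 * A) - \<alpha>"
  using assms by (simp add: phi_i_def phi_eq_moebius_lift moebius_mean_def sum_subtractf diff_divide_distrib)

lemma moebius_mean_add_2pi:
  assumes "N \<ge> 1"
  shows "moebius_mean N \<beta> (a + 2 * pi) = moebius_mean N \<beta> a + 2 * pi"
proof -
  have "moebius_lift \<beta> (t + (a + 2 * pi)) = moebius_lift \<beta> (t + a) + 2 * pi" for t
    using moebius_lift_add_2pi_int[of \<beta> "t + a" 1] by (simp add: add.assoc)
  thus ?thesis
    using assms by (simp add: moebius_mean_def sum.distrib add_divide_distrib)
qed

text \<open>
  The difference between a lift and the identity is odd and periodic, so its mean over the
  midpoints of \<open>N\<close> equal arcs vanishes; any other translate of these points is, up to a rotation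
  permuting them, within \<open>2 \<pi> / N\<close> of this configuration.
\<close>

lemma moebius_mean_bound:
  assumes \<beta>: "\<bar>\<beta>\<bar> \<le> b" "b < 1" and N: "N \<ge> 1"
  shows "\<bar>moebius_mean N \<beta> a - (pi + a)\<bar> \<le> 4 * pi / (1 - b) / real N"
proof -
  define p where "p t = moebius_lift \<beta> t - t" for t
  define s where "s i = 2 * pi * ((2 * real_of_int i - 1) / (2 * real N))" for i :: int
  \<comment> \<open>Translation by \<open>a\<close> is translation by \<open>k\<close> grid steps of
    length 2 pi / N followed by a remainder in [0, 2 pi / N).\<close>
  define k where "k = \<lfloor>a * real N / (2 * pi)\<rfloor>"
  have p_lip: "\<bar>p t - p u\<bar> \<le> 2 / (1 - b) * \<bar>t - u\<bar>" for t u
  proof -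
    have "\<bar>p t - p u\<bar> \<le> (1 + b) / (1 - b) * \<bar>t - u\<bar> + \<bar>t - u\<bar>"
      using moebius_lift_lipschitz[OF \<beta>, of t u] unfolding p_def by linarith
    also have "\<dots> = 2 / (1 - b) * \<bar>t - u\<bar>"
      using \<beta> by (simp add: field_simps)
    finally show ?thesis .
  qed
  have p_per: "p (t + 2 * pi) = p t" for t
    using moebius_lift_add_2pi_int[of \<beta> t 1] by (simp add: p_def)
  have p_odd: "p (2 * pi - t) = - p t" for t
    using p_per[of "- t"] by (simp add: p_def)
  have s_per: "s (i + int N) = s i + 2 * pi" for i
    using N by (simp add: s_def field_simps)
  have s_refl: "s (int N + 1 - i) = 2 * pi - s i" for i
    using N by (simp add: s_def field_simps)
  have s_shift: "s (i + k) = s i + 2 * pi * of_int k / real N" for i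
    using N by (simp add: s_def field_simps)
  have sum_s: "(\<Sum>i=1..N. s (int i)) = pi * real N"
  proof -
    have "(\<Sum>i=1..M. 2 * real i - 1) = real M * real M" for M
      by (induction M) (auto simp: algebra_simps)
    thus ?thesis
      using N by (simp add: s_def sum_distrib_left[symmetric] sum_divide_distrib[symmetric])
  qed
  \<comment> \<open>Reversing the order reflects the grid about pi; since \<open>p\<close> is odd
    and periodic, the sum equals its own negative.\<close>
  have "(\<Sum>i=1..N. p (s (int i))) = (\<Sum>i=1..N. p (s (int (N + 1 - i))))"
    by (rule sum.atLeastAtMost_rev)
  also have "\<dots> = (\<Sum>i=1..N. - p (s (int i)))"
  proof (rule sum.cong)
    fix i assume "i \<in> {1..N}"
    hence "int (N + 1 - i) = int N + 1 - int i"
      by auto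
    thus "p (s (int (N + 1 - i))) = - p (s (int i))"
      by (simp only: s_refl p_odd)
  qed simp
  finally have "(\<Sum>i=1..N. p (s (int i))) = 0"
    by (simp add: sum_negf)
  hence zero: "(\<Sum>i=1..N. p (s (int i + k))) = 0"
    using sum_periodic_shift[of "\<lambda>i. p (s i)" N k] by (simp add: s_per p_per)
  have "of_int k \<le> a * real N / (2 * pi)" "a * real N / (2 * pi) < of_int k + 1"
    unfolding k_def by linarith+
  hence "\<bar>(a * real N - 2 * pi * of_int k) / real N\<bar> \<le> 2 * pi / real N"
    unfolding abs_divide by (intro frac_le) (use N in \<open>auto simp: field_simps\<close>)
  hence \<delta>: "\<bar>a - 2 * pi * of_int k / real N\<bar> \<le> 2 * pi / real N"
    using N by (simp add: diff_divide_distrib)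
  \<comment> \<open>The midpoints have mean pi, hence the centring at \<open>pi + a\<close>.\<close>
  have "(\<Sum>i=1..N. p (s (int i) + a)) = (\<Sum>i=1..N. moebius_lift \<beta> (s (int i) + a)) - (pi * real N + real N * a)"
    by (simp add: p_def sum_subtractf sum.distrib sum_s del: One_nat_def)
  hence "moebius_mean N \<beta> a - (pi + a) = (\<Sum>i=1..N. p (s (int i) + a)) / real N"
    using N by (simp add: moebius_mean_def s_def diff_divide_distrib add_divide_distrib)
  also have "\<dots> = (\<Sum>i=1..N. p (s (int i) + a) - p (s (int i + k))) / real N"
    by (simp add: sum_subtractf zero del: One_nat_def)
  also have "\<bar>\<dots>\<bar> \<le> (\<Sum>i=1..N. 2 / (1 - b) * (2 * pi / real N)) / real N"
  proof -
    have "\<bar>p (s (int i) + a) - p (s (int i + k))\<bar> \<le> 2 / (1 - b) * (2 * pi / real N)" for i :: nat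
    proof -
      have "\<bar>p (s (int i) + a) - p (s (int i + k))\<bar> \<le> 2 / (1 - b) * \<bar>a - 2 * pi * of_int k / real N\<bar>"
        using p_lip[of "s (int i) + a" "s (int i + k)"] by (simp add: s_shift)
      also have "\<dots> \<le> 2 / (1 - b) * (2 * pi / real N)"
        using \<delta> \<beta> by (intro mult_left_mono) auto
      finally show ?thesis .
    qed
    hence "\<bar>\<Sum>i=1..N. p (s (int i) + a) - p (s (int i + k))\<bar> \<le> (\<Sum>i=1..N. 2 / (1 - b) * (2 * pi / real N))"
      by (intro order.trans[OF sum_abs] sum_mono) auto
    thus ?thesis
      by (simp add: abs_divide divide_right_mono)
  qed
  also have "\<dots> = 4 * pi / (1 - b) / real N"
    using N by simp
  finally show ?thesis .
qed

text \<open>The mean is continuous and gains 2 pi as \<open>A\<close> crosses its interval, so its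
  range contains a representative of every class modulo 2 pi.\<close>

lemma moebius_mean_surj:
  assumes \<beta>: "\<bar>\<beta>\<bar> < 1" and N: "N \<ge> 1"
  obtains A and m :: int where "A \<in> {-(pi/2)..pi/2}" "moebius_mean N \<beta> (2 * A) = v + 2 * pi * of_int m"
proof -
  let ?T = "\<lambda>A. moebius_mean N \<beta> (2 * A)"
  \<comment> \<open>Chosen so that \<open>v + 2 * pi * m\<close> lies between the values of the mean
    at the two ends of the interval.\<close>
  define m where "m = - \<lfloor>(v - ?T (- (pi / 2))) / (2 * pi)\<rfloor>"
  have T: "?T (pi / 2) = ?T (- (pi / 2)) + 2 * pi"
    using moebius_mean_add_2pi[OF N, of \<beta> "- pi"] by simp
  have "of_int (- m) \<le> (v - ?T (- (pi / 2))) / (2 * pi)" "(v - ?T (- (pi / 2))) / (2 * pi) < of_int (- m) + 1"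
    unfolding m_def by linarith+
  hence "?T (- (pi / 2)) \<le> v + 2 * pi * of_int m" "v + 2 * pi * of_int m \<le> ?T (pi / 2)"
    unfolding T by (auto simp: field_simps)
  moreover have "continuous_on {- (pi / 2)..pi / 2} ?T"
    unfolding moebius_mean_def
    by (intro continuous_intros continuous_on_compose2[OF continuous_moebius_lift[OF \<beta>, of UNIV]]) (use N in auto)
  ultimately obtain A where "- (pi / 2) \<le> A" "A \<le> pi / 2" "?T A = v + 2 * pi * of_int m"
    using IVT'[of ?T "- (pi / 2)" "v + 2 * pi * of_int m" "pi / 2"] by auto
  thus ?thesis by (intro that[of A m]) auto
qed

section \<open>Pairing of finite-dimensional and continuum profiles\<close>

lemma to_circle_add_2pi_int: "to_circle (x + 2 * pi * of_int k) = to_circle x"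
  by (rule sym) (unfold to_circle_eq_iff', blast)

lemma to_circle_add: "to_circle (x + y) = to_circle x + to_circle y"
  by (simp add: plus_circle.abs_eq)

lemma to_circle_diff: "to_circle (x - y) = to_circle x - to_circle y"
  by (simp add: minus_circle.abs_eq)

text \<open>The members of \<open>Wu_y\<close> in closed form, kept on the whole line so that
  measurability and laws can be studied without the value \<open>undefined\<close> outside
  [0,1].\<close>

definition oa_profile :: "real \<Rightarrow> real \<Rightarrow> real \<Rightarrow> real \<Rightarrow> circle" where
  "oa_profile \<alpha> \<beta> r \<xi> = to_circle (moebius_lift \<beta> (2 * pi * \<xi> + \<alpha> + r) - \<alpha>)"

lemma oa_profile_add_2pi_int: "oa_profile \<alpha> \<beta> (r + 2 * pi * of_int k) = oa_profile \<alpha> \<beta> r"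
proof
  fix \<xi>
  have "moebius_lift \<beta> (2 * pi * \<xi> + \<alpha> + (r + 2 * pi * of_int k)) - \<alpha> =
      (moebius_lift \<beta> (2 * pi * \<xi> + \<alpha> + r) - \<alpha>) + 2 * pi * of_int k"
    using moebius_lift_add_2pi_int[of \<beta> "2 * pi * \<xi> + \<alpha> + r" k] by (simp add: add.assoc)
  thus "oa_profile \<alpha> \<beta> (r + 2 * pi * of_int k) \<xi> = oa_profile \<alpha> \<beta> r \<xi>"
    by (simp only: oa_profile_def to_circle_add_2pi_int)
qed

text \<open>The Lipschitz constant of the lift times N times the bound on the argument error: pi / N
  for half a grid cell, and the bound of \<open>moebius_mean_bound\<close> for the discrete
  mean.\<close>

definition profile_error :: "real \<Rightarrow> real" where
  "profile_error b = (1 + b) / (1 - b) * (pi + 4 * pi / (1 - b))"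

lemma profile_error_pos: "0 \<le> b \<Longrightarrow> b < 1 \<Longrightarrow> profile_error b > 0"
  unfolding profile_error_def by (intro mult_pos_pos divide_pos_pos add_pos_pos[of pi]) auto

text \<open>Both profiles apply the same lift and subtract the same \<alpha>, so only the arguments
  need comparing. The phase is the mean of the real-valued samples minus pi, as the mean condition
  dictates.\<close>

lemma step_lift_close_profile:
  assumes \<beta>: "\<beta> \<in> {0..b}" "b < 1" and N: "N \<ge> 1" and \<xi>: "\<xi> \<in> {0..1}"
  shows "dist (step_lift N (\<lambda>i\<in>{1..N}. to_circle (phi_i N i \<alpha> \<beta> A)) \<xi>)
           (oa_profile \<alpha> \<beta> (moebius_mean N \<beta> (2 * A) - \<alpha> - pi) \<xi>) \<le> profile_error b / real N"
proof -
  \<comment> \<open>At \<xi> = 1 the floor equals \<open>N\<close>; \<open>min\<close> keeps the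
    index in the last cell, and the upper bound on N \<xi> below is therefore non-strict.\<close>
  define i where "i = min N (nat \<lfloor>real N * \<xi>\<rfloor> + 1)"
  have i: "i \<in> {1..N}"
    using N by (auto simp: i_def)
  have N\<xi>: "0 \<le> real N * \<xi>" "real N * \<xi> \<le> real N"
    using \<xi> by (auto intro: mult_left_le)
  have "real i - 1 \<le> real N * \<xi>"
    using N\<xi> unfolding i_def by linarith
  moreover have "real N * \<xi> \<le> real i"
    using N\<xi> unfolding i_def by linarith
  \<comment> \<open>The sample point is the midpoint of the cell that contains \<xi>.\<close>
  ultimately have close: "\<bar>(2 * real i - 1) / (2 * real N) - \<xi>\<bar> \<le> 1 / (2 * real N)"
    using N by (simp add: abs_le_iff field_simps)
  define t where "t = 2 * pi * ((2 * real i - 1) / (2 * real N)) + 2 * A"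
  define u where "u = 2 * pi * \<xi> + (moebius_mean N \<beta> (2 * A) - pi)"
  have \<beta>': "\<bar>\<beta>\<bar> \<le> b" "\<bar>\<beta>\<bar> < 1"
    using \<beta> by auto
  have "t - u = 2 * pi * ((2 * real i - 1) / (2 * real N) - \<xi>) - (moebius_mean N \<beta> (2 * A) - (pi + 2 * A))"
    by (simp add: t_def u_def algebra_simps)
  also have "\<bar>\<dots>\<bar> \<le> 2 * pi * \<bar>(2 * real i - 1) / (2 * real N) - \<xi>\<bar> + \<bar>moebius_mean N \<beta> (2 * A) - (pi + 2 * A)\<bar>"
    by (rule order.trans[OF abs_triangle_ineq4]) (simp add: abs_mult)
  also have "\<dots> \<le> 2 * pi * (1 / (2 * real N)) + 4 * pi / (1 - b) / real N"
    using close by (intro add_mono mult_left_mono moebius_mean_bound) (use \<beta> \<beta>' N in auto)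
  also have "\<dots> = (pi + 4 * pi / (1 - b)) / real N"
    by (simp add: add_divide_distrib)
  finally have tu: "\<bar>t - u\<bar> \<le> (pi + 4 * pi / (1 - b)) / real N" .
  have phi_i: "phi_i N i \<alpha> \<beta> A = moebius_lift \<beta> t - \<alpha>"
    by (simp add: phi_i_def phi_eq_moebius_lift[OF \<beta>'(2)] t_def)
  have "2 * pi * \<xi> + \<alpha> + (moebius_mean N \<beta> (2 * A) - \<alpha> - pi) = u"
    by (simp add: u_def)
  hence "dist (to_circle (phi_i N i \<alpha> \<beta> A)) (oa_profile \<alpha> \<beta> (moebius_mean N \<beta> (2 * A) - \<alpha> - pi) \<xi>)
      = dist (to_circle (moebius_lift \<beta> t - \<alpha>)) (to_circle (moebius_lift \<beta> u - \<alpha>))"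
    by (simp only: phi_i oa_profile_def)
  also have "\<dots> \<le> \<bar>moebius_lift \<beta> t - moebius_lift \<beta> u\<bar>"
    using dist_circle_le[of "moebius_lift \<beta> t - \<alpha>" "moebius_lift \<beta> u - \<alpha>"] by simp
  also have "\<dots> \<le> (1 + b) / (1 - b) * \<bar>t - u\<bar>"
    by (rule moebius_lift_lipschitz[OF \<beta>'(1) \<beta>(2)])
  also have "\<dots> \<le> (1 + b) / (1 - b) * ((pi + 4 * pi / (1 - b)) / real N)"
    using tu \<beta> by (intro mult_left_mono) auto
  also have "\<dots> = profile_error b / real N"
    by (simp add: profile_error_def)
  finally have "dist (to_circle (phi_i N i \<alpha> \<beta> A)) (oa_profile \<alpha> \<beta> (moebius_mean N \<beta> (2 * A) - \<alpha> - pi) \<xi>)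
      \<le> profile_error b / real N" .
  moreover have "step_lift N x \<xi> = x i" for x
    using \<xi> by (simp add: step_lift_def i_def)
  ultimately show ?thesis
    using i by simp
qed

lemma Wu_theta_close_profile:
  assumes "bt < 1" "N \<ge> 1" "x \<in> Wu_theta N q bt"
  obtains \<alpha> \<beta> r where "\<beta> \<in> {0..bt}" "\<alpha> \<in> {-pi..pi}" "to_circle r = q - to_circle pi"
    "\<forall>\<xi>\<in>{0..1}. dist (step_lift N x \<xi>) (oa_profile \<alpha> \<beta> r \<xi>) \<le> profile_error bt / real N"
proof -
  obtain \<alpha> \<beta> A where x: "x = (\<lambda>i\<in>{1..N}. to_circle (phi_i N i \<alpha> \<beta> A))"
    and p: "\<beta> \<in> {0..bt}" "\<alpha> \<in> {-pi..pi}"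
    and q: "to_circle ((\<Sum>i=1..N. phi_i N i \<alpha> \<beta> A) / real N) = q"
    using assms(3) unfolding Wu_theta_def by blast
  show ?thesis
  proof (rule that[OF p])
    have \<beta>: "\<bar>\<beta>\<bar> < 1" using p assms(1) by auto
    show "to_circle (moebius_mean N \<beta> (2 * A) - \<alpha> - pi) = q - to_circle pi"
      using q unfolding mean_phi_i[OF \<beta> assms(2)] to_circle_diff[of _ pi] by simp
  next
    show "\<forall>\<xi>\<in>{0..1}. dist (step_lift N x \<xi>)
        (oa_profile \<alpha> \<beta> (moebius_mean N \<beta> (2 * A) - \<alpha> - pi) \<xi>) \<le> profile_error bt / real N"
      unfolding x by (intro ballI step_lift_close_profile[OF p(1) assms(1,2)])
  qed
qed

text \<open>Here the phase is prescribed and \<open>A\<close> must be found. The intermediate value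
  argument matches the mean to \<open>r + pi\<close> up to a multiple of 2 pi, which the profile
  does not see.\<close>

lemma profile_close_Wu_theta:
  assumes "bt < 1" "N \<ge> 1" "\<beta> \<in> {0..bt}" "\<alpha> \<in> {-pi..pi}" "to_circle r = q - to_circle pi"
  obtains x where "x \<in> Wu_theta N q bt"
    "\<forall>\<xi>\<in>{0..1}. dist (step_lift N x \<xi>) (oa_profile \<alpha> \<beta> r \<xi>) \<le> profile_error bt / real N"
proof -
  have \<beta>: "\<bar>\<beta>\<bar> < 1" using assms by auto
  obtain A and m :: int where A: "A \<in> {-(pi/2)..pi/2}"
    and m: "moebius_mean N \<beta> (2 * A) = (pi + \<alpha> + r) + 2 * pi * of_int m"
    using moebius_mean_surj[OF \<beta> assms(2)] .
  let ?x = "\<lambda>i\<in>{1..N}. to_circle (phi_i N i \<alpha> \<beta> A)"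
  have "(\<Sum>i=1..N. phi_i N i \<alpha> \<beta> A) / real N = (r + pi) + 2 * pi * of_int m"
    unfolding mean_phi_i[OF \<beta> assms(2)] m by simp
  hence "to_circle ((\<Sum>i=1..N. phi_i N i \<alpha> \<beta> A) / real N) = to_circle (r + pi)"
    by (simp only: to_circle_add_2pi_int)
  hence "to_circle ((\<Sum>i=1..N. phi_i N i \<alpha> \<beta> A) / real N) = q"
    by (simp add: to_circle_add assms(5))
  hence "?x \<in> Wu_theta N q bt"
    unfolding Wu_theta_def using A assms by blast
  moreover have "oa_profile \<alpha> \<beta> (moebius_mean N \<beta> (2 * A) - \<alpha> - pi) = oa_profile \<alpha> \<beta> r"
    using oa_profile_add_2pi_int[of \<alpha> \<beta> r m] by (simp add: m)
  ultimately show ?thesis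
    using step_lift_close_profile[OF assms(3,1,2), where \<alpha> = \<alpha> and A = A]
    by (intro that[of ?x]) auto
qed


section \<open>Couplings induced by functions on the unit interval\<close>

lemma nn_integral_periodic:
  fixes f :: "real \<Rightarrow> ennreal"
  assumes [measurable]: "f \<in> borel_measurable borel" and T: "T > 0" and per: "\<And>x. f (x + T) = f x"
  shows "(\<integral>\<^sup>+x\<in>{a..<a + T}. f x \<partial>lborel) = (\<integral>\<^sup>+x\<in>{b..<b + T}. f x \<partial>lborel)"
proof -
  define I where "I u v = (\<integral>\<^sup>+x\<in>{u..<v}. f x \<partial>lborel)" for u v
  have I_shift: "I (u + T) (v + T) = I u v" for u v
  proof -
    have "I (u + T) (v + T) = (\<integral>\<^sup>+x. f (T + 1 * x) * indicator {u + T..<v + T} (T + 1 * x) \<partial>lborel)"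
      unfolding I_def by (subst nn_integral_real_affine[of _ 1 T]) simp_all
    also have "\<dots> = I u v"
      unfolding I_def by (intro nn_integral_cong) (auto simp: add.commute per indicator_def)
    finally show ?thesis .
  qed
  have I_split: "I u w = I u v + I v w" if "u \<le> v" "v \<le> w" for u v w
    unfolding I_def using that
    by (subst nn_integral_add[symmetric]) (auto intro!: nn_integral_cong simp: indicator_def)
  have step: "I (u + T) (u + T + T) = I u (u + T)" for u
    by (rule I_shift)
  have shift: "I (u + of_int k * T) (u + of_int k * T + T) = I u (u + T)" for u and k :: int
  proof (induction k rule: int_induct[of _ 0])
    case (step1 i)
    thus ?case using step[of "u + of_int i * T"] by (simp add: algebra_simps)
  next
    case (step2 i)
    thus ?case using step[of "u + of_int (i - 1) * T"] by (simp add: algebra_simps)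
  qed simp
  \<comment> \<open>The window at \<open>b\<close> is moved by whole periods to start at
    \<open>c\<close>, the last such point not beyond \<open>a\<close>. The piece [c, a) then
    reappears as [c + T, a + T).\<close>
  define k where "k = \<lfloor>(a - b) / T\<rfloor>"
  define c where "c = b + of_int k * T"
  have "of_int k \<le> (a - b) / T" "(a - b) / T < of_int k + 1"
    unfolding k_def by linarith+
  hence c: "c \<le> a" "a \<le> c + T"
    using T by (auto simp: c_def field_simps)
  have "I a (a + T) = I a (c + T) + I (c + T) (a + T)"
    using c by (intro I_split) auto
  also have "I (c + T) (a + T) = I c a"
    by (rule I_shift)
  also have "I a (c + T) + I c a = I c (c + T)"
    using c by (subst I_split[of c a "c + T"]) (auto simp: add.commute)
  also have "\<dots> = I b (b + T)"
    unfolding c_def by (rule shift)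
  finally show ?thesis by (simp add: I_def)
qed

lemma nn_integral_atLeastAtMost_eq_atLeastLessThan:
  fixes f :: "real \<Rightarrow> ennreal"
  shows "(\<integral>\<^sup>+x\<in>{a..b}. f x \<partial>lborel) = (\<integral>\<^sup>+x\<in>{a..<b}. f x \<partial>lborel)"
  by (intro nn_integral_cong_AE) (use AE_lborel_singleton[of b] in \<open>eventually_elim, auto simp: indicator_def\<close>)

lemma borel_measurable_oa_profile:
  assumes "\<bar>\<beta>\<bar> < 1"
  shows "oa_profile \<alpha> \<beta> r \<in> borel_measurable borel"
proof -
  note borel_measurable_moebius_lift[OF assms, measurable]
  show ?thesis
    unfolding oa_profile_def[abs_def] by measurable
qed

text \<open>Substitute \<xi> = H(x), where \<open>H\<close> inverts the real-valued profile and has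
  the density as derivative. The phase \<open>r\<close> only moves the starting point of the period,
  so the law does not depend on it.\<close>

lemma distr_oa_profile:
  assumes \<beta>: "\<bar>\<beta>\<bar> < 1"
  shows "distr (restrict_space lborel {0..<1}) borel (oa_profile \<alpha> \<beta> r) = oa_measure \<alpha> \<beta>"
proof (rule measure_eqI)
  fix S assume "S \<in> sets (distr (restrict_space lborel {0..<1}) borel (oa_profile \<alpha> \<beta> r))"
  hence S [measurable]: "S \<in> sets borel" by simp
  note [measurable] = borel_measurable_oa_profile[OF \<beta>]
  have \<beta>': "\<bar>- \<beta>\<bar> < 1" using \<beta> by simp
  have [measurable]: "oa_density \<alpha> \<beta> \<in> borel_measurable borel"
    unfolding oa_density_def[abs_def] by measurable
  define H where "H x = (moebius_lift (- \<beta>) (x + \<alpha>) - \<alpha> - r) / (2 * pi)" for x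
  \<comment> \<open>The value of the real-valued profile at \<xi> = 0, so \<open>H\<close> maps one
    period starting at \<open>a\<close> onto [0,1].\<close>
  define a where "a = moebius_lift \<beta> (\<alpha> + r) - \<alpha>"
  have Ha: "H a = 0"
    by (simp add: H_def a_def moebius_lift_inverse[OF \<beta>])
  have "H (a + 2 * pi) = H a + 1"
    using moebius_lift_add_2pi_int[of "- \<beta>" "a + \<alpha>" 1] by (simp add: H_def field_simps)
  hence Hb: "H (a + 2 * pi) = 1"
    by (simp add: Ha)
  have profile_H: "oa_profile \<alpha> \<beta> r (H x) = to_circle x" for x
    using moebius_lift_inverse[OF \<beta>'] by (simp add: oa_profile_def H_def)
  have H_deriv: "(H has_real_derivative oa_density \<alpha> \<beta> x) (at x)" for x
    unfolding H_def[abs_def] oa_density_eq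
    by (auto intro!: derivative_eq_intros DERIV_chain2[OF has_real_derivative_moebius_lift[OF \<beta>']])
  have cont: "continuous_on {a..a + 2 * pi} (oa_density \<alpha> \<beta>)"
    unfolding oa_density_eq[abs_def]
    by (intro continuous_intros continuous_on_compose2[OF continuous_moebius_deriv[OF \<beta>', of UNIV]]) auto
  have nonneg: "0 \<le> oa_density \<alpha> \<beta> x" for x
    unfolding oa_density_eq using moebius_deriv_nonneg[OF \<beta>'] by simp
  have circle_per: "to_circle (x + 2 * pi) = to_circle x" for x
    using to_circle_add_2pi_int[of x 1] by simp
  let ?f = "\<lambda>\<xi>. indicat_real S (oa_profile \<alpha> \<beta> r \<xi>)"
  have "emeasure (distr (restrict_space lborel {0..<1}) borel (oa_profile \<alpha> \<beta> r)) S
      = (\<integral>\<^sup>+\<xi>. indicator S \<xi> \<partial>distr (restrict_space lborel {0..<1}) borel (oa_profile \<alpha> \<beta> r))"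
    by simp
  also have "\<dots> = (\<integral>\<^sup>+\<xi>. indicator S (oa_profile \<alpha> \<beta> r \<xi>) \<partial>restrict_space lborel {0..<1})"
    by (intro nn_integral_distr measurable_restrict_space1) simp_all
  also have "\<dots> = (\<integral>\<^sup>+\<xi>\<in>{0..<1}. indicator S (oa_profile \<alpha> \<beta> r \<xi>) \<partial>lborel)"
    by (simp add: nn_integral_restrict_space)
  \<comment> \<open>The substitution rule is applied on closed intervals; the added endpoint is a
    null set.\<close>
  also have "\<dots> = (\<integral>\<^sup>+\<xi>. ennreal (?f \<xi> * indicat_real {H a..H (a + 2 * pi)} \<xi>) \<partial>lborel)"
    unfolding Ha Hb
    by (subst nn_integral_atLeastAtMost_eq_atLeastLessThan[symmetric])
       (auto intro!: nn_integral_cong simp: indicator_def)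
  also have "\<dots> = (\<integral>\<^sup>+x. ennreal (?f (H x) * oa_density \<alpha> \<beta> x * indicat_real {a..a + 2 * pi} x) \<partial>lborel)"
    by (rule nn_integral_substitution[OF _ H_deriv cont nonneg])
       (auto simp: set_borel_measurable_def)
  also have "\<dots> = (\<integral>\<^sup>+x\<in>{a..a + 2 * pi}. ennreal (oa_density \<alpha> \<beta> x) * indicator S (to_circle x) \<partial>lborel)"
    by (intro nn_integral_cong) (auto simp: profile_H indicator_def)
  also have "\<dots> = (\<integral>\<^sup>+x\<in>{a..<a + 2 * pi}. ennreal (oa_density \<alpha> \<beta> x) * indicator S (to_circle x) \<partial>lborel)"
    by (rule nn_integral_atLeastAtMost_eq_atLeastLessThan)
  \<comment> \<open>Periodicity moves the window to the fundamental interval used in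
    \<open>oa_measure\<close>.\<close>
  also have "\<dots> = (\<integral>\<^sup>+x\<in>{-pi..<-pi + 2 * pi}. ennreal (oa_density \<alpha> \<beta> x) * indicator S (to_circle x) \<partial>lborel)"
    by (rule nn_integral_periodic) (simp_all add: circle_per oa_density_def add.assoc[symmetric])
  also have "\<dots> = (\<integral>\<^sup>+x. ennreal (oa_density \<alpha> \<beta> x) * indicator S (to_circle x) \<partial>restrict_space lborel {-pi..<pi})"
    by (simp add: nn_integral_restrict_space)
  also have "\<dots> = (\<integral>\<^sup>+x. indicator S (to_circle x)
      \<partial>density (restrict_space lborel {-pi..<pi}) (\<lambda>\<theta>. ennreal (oa_density \<alpha> \<beta> \<theta>)))"
    by (intro nn_integral_density[symmetric] measurable_restrict_space1) simp_all
  also have "\<dots> = (\<integral>\<^sup>+x. indicator S x \<partial>oa_measure \<alpha> \<beta>)"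
    unfolding oa_measure_def
    by (intro nn_integral_distr[symmetric]) (simp_all add: measurable_restrict_space1)
  also have "\<dots> = emeasure (oa_measure \<alpha> \<beta>) S"
    by (simp add: oa_measure_def)
  finally show "emeasure (distr (restrict_space lborel {0..<1}) borel (oa_profile \<alpha> \<beta> r)) S
      = emeasure (oa_measure \<alpha> \<beta>) S" .
qed (simp add: oa_measure_def)

section \<open>The law of a step function\<close>

definition step_fun :: "nat \<Rightarrow> (nat \<Rightarrow> 'a) \<Rightarrow> real \<Rightarrow> 'a" where
  "step_fun N x \<xi> = x (min N (nat \<lfloor>real N * \<xi>\<rfloor> + 1))"

lemma step_lift_eq_step_fun: "\<xi> \<in> {0..1} \<Longrightarrow> step_lift N x \<xi> = step_fun N x \<xi>"
  by (simp add: step_lift_def step_fun_def)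

text \<open>The function factors through a measurable index with values in a countable set.\<close>

lemma borel_measurable_step_fun: "step_fun N x \<in> borel_measurable borel"
proof -
  have "(\<lambda>\<xi>. min N (nat \<lfloor>real N * \<xi>\<rfloor> + 1)) \<in> borel \<rightarrow>\<^sub>M count_space UNIV"
    by measurable
  thus ?thesis
    unfolding step_fun_def[abs_def] by (rule measurable_compose_countable[rotated]) simp
qed

lemma distr_step_fun:
  assumes N: "N \<ge> 1"
  shows "distr (restrict_space lborel {0..<1}) borel (step_fun N x) = empirical_measure N x"
proof (rule measure_eqI)
  fix S assume "S \<in> sets (distr (restrict_space lborel {0..<1}) borel (step_fun N x))"
  hence S [measurable]: "S \<in> sets borel" by simp
  note [measurable] = borel_measurable_step_fun
  let ?J = "\<lambda>i. {(real i - 1) / real N..<real i / real N}"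
  \<comment> \<open>The cells partition [0,1), and each of them will contribute its length 1 /
    N.\<close>
  have indicator_J: "indicator S (step_fun N x \<xi>) * indicator {0..<1} \<xi> =
      (\<Sum>i=1..N. indicator S (x i) * indicator (?J i) \<xi> :: ennreal)" for \<xi>
  proof (cases "\<xi> \<in> {0..<1}")
    case True
    \<comment> \<open>For \<xi> < 1 this index is at most \<open>N\<close>, so the
      \<open>min\<close> in \<open>step_fun\<close> has no effect.\<close>
    define j where "j = nat \<lfloor>real N * \<xi>\<rfloor> + 1"
    have "0 \<le> real N * \<xi>" "real N * \<xi> < real N"
      using True N by auto
    hence j: "real j - 1 \<le> real N * \<xi>" "real N * \<xi> < real j" "j \<in> {1..N}"
      unfolding j_def by (linarith, linarith, simp) linarith
    have J: "\<xi> \<in> ?J i \<longleftrightarrow> i = j" for i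
    proof -
      have "\<xi> \<in> ?J i \<longleftrightarrow> real i - 1 \<le> real N * \<xi> \<and> real N * \<xi> < real i"
        using N by (simp add: field_simps)
      also have "\<dots> \<longleftrightarrow> i = j"
        using j by (auto; linarith)
      finally show ?thesis .
    qed
    have "(\<Sum>i=1..N. indicator S (x i) * indicator (?J i) \<xi> :: ennreal) =
        (\<Sum>i=1..N. if i = j then indicator S (x i) else 0)"
      by (intro sum.cong) (simp_all only: indicator_def J, simp_all)
    moreover have "step_fun N x \<xi> = x j"
      using j(3) unfolding step_fun_def j_def[symmetric] by (simp add: min_absorb2)
    ultimately show ?thesis
      using True j(3) by simp
  next
    case False
    have "\<xi> \<notin> ?J i" if "i \<in> {1..N}" for i
    proof
      assume "\<xi> \<in> ?J i"
      hence "real i - 1 \<le> real N * \<xi>" "real N * \<xi> < real i"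
        using N by (simp_all add: field_simps)
      moreover have "1 \<le> real i" "real i \<le> real N"
        using that by auto
      ultimately have "real N * 0 \<le> real N * \<xi>" "real N * \<xi> < real N * 1"
        by linarith+
      moreover have "real N > 0"
        using N by simp
      ultimately have "0 \<le> \<xi>" "\<xi> < 1"
        unfolding mult_le_cancel_left_pos[OF \<open>real N > 0\<close>] mult_less_cancel_left_pos[OF \<open>real N > 0\<close>] by auto
      thus False
        using False by simp
    qed
    thus ?thesis using False by simp
  qed
  have J_measure: "emeasure lborel (?J i) = 1 / of_nat N" for i
  proof -
    have "emeasure lborel (?J i) = ennreal (real i / real N - (real i - 1) / real N)"
      by (rule emeasure_lborel_Ico) (simp add: divide_right_mono)
    also have "real i / real N - (real i - 1) / real N = 1 / real N"
      by (simp add: diff_divide_distrib)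
    also have "ennreal (1 / real N) = ennreal 1 / ennreal (real N)"
      by (rule divide_ennreal[symmetric]) (use N in auto)
    also have "\<dots> = 1 / of_nat N"
      by (simp add: ennreal_of_nat_eq_real_of_nat)
    finally show ?thesis .
  qed
  have "emeasure (distr (restrict_space lborel {0..<1}) borel (step_fun N x)) S
      = (\<integral>\<^sup>+\<xi>. indicator S \<xi> \<partial>distr (restrict_space lborel {0..<1}) borel (step_fun N x))"
    by simp
  also have "\<dots> = (\<integral>\<^sup>+\<xi>. indicator S (step_fun N x \<xi>) \<partial>restrict_space lborel {0..<1})"
    by (intro nn_integral_distr measurable_restrict_space1) simp_all
  also have "\<dots> = (\<integral>\<^sup>+\<xi>. (\<Sum>i=1..N. indicator S (x i) * indicator (?J i) \<xi>) \<partial>lborel)"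
    by (simp add: nn_integral_restrict_space indicator_J)
  also have "\<dots> = (\<Sum>i=1..N. indicator S (x i) * emeasure lborel (?J i))"
    by (subst nn_integral_sum) (simp_all add: nn_integral_cmult)
  also have "\<dots> = (\<Sum>i=1..N. indicator S (x i)) / of_nat N"
    by (simp only: J_measure sum_distrib_right[symmetric]) (simp add: divide_ennreal_def)
  also have "\<dots> = emeasure (empirical_measure N x) S"
    by (simp add: emeasure_empirical_measure)
  finally show "emeasure (distr (restrict_space lborel {0..<1}) borel (step_fun N x)) S
      = emeasure (empirical_measure N x) S" .
qed simp

section \<open>From uniform closeness to Wasserstein, essential supremum and Hausdorff
  bounds\<close>

lemma ennreal_powr_le:
  assumes "x \<le> ennreal (c powr p)" "0 \<le> c" "p > 0"
  shows "ennreal_powr x (1 / p) \<le> ennreal c"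
proof -
  have x: "x \<noteq> \<infinity>"
    using assms(1) by (auto simp: top_unique)
  have "enn2real x \<le> c powr p"
    using assms(1) by (metis enn2real_mono enn2real_ennreal ennreal_less_top powr_ge_zero)
  hence "enn2real x powr (1 / p) \<le> (c powr p) powr (1 / p)"
    using assms by (intro powr_mono2) auto
  also have "\<dots> = c"
    using assms by (simp add: powr_powr)
  finally show ?thesis
    using x by (simp add: ennreal_powr_def ennreal_leI)
qed

text \<open>The joint law of \<open>X\<close> and \<open>Y\<close> is a coupling of total mass 1
  whose cost is at most c^p; the root restores \<open>c\<close>, whatever the exponent.\<close>

lemma wasserstein_distr_le:
  fixes X Y :: "'b \<Rightarrow> 'a::{metric_space, second_countable_topology}"
  assumes [measurable]: "X \<in> borel_measurable M" "Y \<in> borel_measurable M"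
    and prob: "emeasure M (space M) = 1"
    and le: "\<And>\<omega>. \<omega> \<in> space M \<Longrightarrow> dist (X \<omega>) (Y \<omega>) \<le> c" and c: "0 \<le> c" and p: "p > 0"
  shows "wasserstein p (distr M borel X) (distr M borel Y) \<le> ennreal c"
proof -
  define \<gamma> where "\<gamma> = distr M (borel \<Otimes>\<^sub>M borel) (\<lambda>\<omega>. (X \<omega>, Y \<omega>))"
  have "\<gamma> \<in> couplings (distr M borel X) (distr M borel Y)"
    unfolding couplings_def \<gamma>_def by (auto simp: distr_distr comp_def)
  hence "(INF \<gamma>\<in>couplings (distr M borel X) (distr M borel Y). \<integral>\<^sup>+ (x, y). ennreal (dist x y powr p) \<partial>\<gamma>)
      \<le> (\<integral>\<^sup>+ (x, y). ennreal (dist x y powr p) \<partial>\<gamma>)"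
    by (rule INF_lower)
  also have "\<dots> = (\<integral>\<^sup>+\<omega>. ennreal (dist (X \<omega>) (Y \<omega>) powr p) \<partial>M)"
    unfolding \<gamma>_def by (subst nn_integral_distr) simp_all
  also have "\<dots> \<le> (\<integral>\<^sup>+\<omega>. ennreal (c powr p) \<partial>M)"
    using le p by (intro nn_integral_mono ennreal_leI powr_mono2) auto
  also have "\<dots> = ennreal (c powr p)"
    by (simp add: prob)
  finally show ?thesis
    unfolding wasserstein_def using c p by (intro ennreal_powr_le)
qed

lemma wasserstein_empirical_oa_le:
  assumes \<beta>: "\<bar>\<beta>\<bar> < 1" and N: "N \<ge> 1" and c: "0 \<le> c" and p: "p > 0"
    and le: "\<And>\<xi>. \<xi> \<in> {0..1} \<Longrightarrow> dist (step_lift N x \<xi>) (oa_profile \<alpha> \<beta> r \<xi>) \<le> c"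
  shows "wasserstein p (empirical_measure N x) (oa_measure \<alpha> \<beta>) \<le> ennreal c"
  unfolding distr_step_fun[OF N, symmetric] distr_oa_profile[OF \<beta>, of \<alpha> r, symmetric]
proof (rule wasserstein_distr_le[OF _ _ _ _ c p])
  fix \<xi> :: real assume "\<xi> \<in> space (restrict_space lborel {0..<1})"
  hence "\<xi> \<in> {0..1}" by (auto simp: space_restrict_space)
  thus "dist (step_fun N x \<xi>) (oa_profile \<alpha> \<beta> r \<xi>) \<le> c"
    using le by (simp add: step_lift_eq_step_fun)
qed (use borel_measurable_step_fun[of N x] borel_measurable_oa_profile[OF \<beta>, of \<alpha> r]
     in \<open>auto intro!: measurable_restrict_space1 simp: space_restrict_space emeasure_restrict_space\<close>)

lemma linf_dist_step_lift_le:
  assumes \<beta>: "\<bar>\<beta>\<bar> < 1"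
    and le: "\<And>\<xi>. \<xi> \<in> {0..1} \<Longrightarrow> dist (step_lift N x \<xi>) (oa_profile \<alpha> \<beta> r \<xi>) \<le> c"
  shows "linf_dist (step_lift N x) (\<lambda>\<xi>\<in>{0..1}. oa_profile \<alpha> \<beta> r \<xi>) \<le> ennreal c"
  unfolding linf_dist_def
proof (rule esssup_I)
  \<comment> \<open>Measurability matters here: \<open>esssup\<close> is top for functions that are
    not measurable. On [0,1] the distance agrees with that of two Borel functions.\<close>
  note [measurable] = borel_measurable_step_fun borel_measurable_oa_profile[OF \<beta>]
  have "(\<lambda>\<xi>. ennreal (dist (step_fun N x \<xi>) (oa_profile \<alpha> \<beta> r \<xi>))) \<in> borel_measurable lborel"
    by measurable
  hence "(\<lambda>\<xi>. ennreal (dist (step_fun N x \<xi>) (oa_profile \<alpha> \<beta> r \<xi>))) \<in> borel_measurable (lebesgue_on {0..1})"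
    by (intro measurable_restrict_space1 measurable_completion)
  thus "(\<lambda>\<xi>. ennreal (dist (step_lift N x \<xi>) ((\<lambda>\<xi>\<in>{0..1}. oa_profile \<alpha> \<beta> r \<xi>) \<xi>)))
      \<in> borel_measurable (lebesgue_on {0..1})"
    by (subst measurable_cong[where g = "\<lambda>\<xi>. ennreal (dist (step_fun N x \<xi>) (oa_profile \<alpha> \<beta> r \<xi>))"])
       (auto simp: step_lift_eq_step_fun)
  show "AE \<xi> in lebesgue_on {0..1}.
      ennreal (dist (step_lift N x \<xi>) ((\<lambda>\<xi>\<in>{0..1}. oa_profile \<alpha> \<beta> r \<xi>) \<xi>)) \<le> ennreal c"
    by (rule AE_I2) (auto intro!: ennreal_leI le)
qed

lemma hausdorff_dist_le:
  assumes "\<And>a. a \<in> A \<Longrightarrow> \<exists>b\<in>B. d a b \<le> c" "\<And>b. b \<in> B \<Longrightarrow> \<exists>a\<in>A. d a b \<le> c"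
  shows "hausdorff_dist d A B \<le> c"
  unfolding hausdorff_dist_def
  by (intro max.boundedI SUP_least) (use assms in \<open>meson INF_lower2\<close>)+

theorem theorem4p2:
  fixes bt :: real
  assumes "0 \<le> bt" and "bt < 1"
  shows "\<exists>C>0. \<forall>p\<ge>1. \<exists>Cp>0. \<forall>N\<ge>3. \<forall>q.
    hausdorff_dist (wasserstein p) (empirical_measure N ` Wu_theta N q bt) (M_OA bt)
      \<le> ennreal (Cp / real N) \<and>
    hausdorff_dist linf_dist (step_lift N ` Wu_theta N q bt) (Wu_y (q - to_circle pi) bt)
      \<le> ennreal (C / real N)"
proof -
  \<comment> \<open>One constant serves as \<open>C\<close> and as every \<open>Cp\<close>, because
    uniform closeness bounds all Wasserstein distances alike.\<close>
  let ?C = "profile_error bt"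
  have C: "?C > 0"
    using assms by (rule profile_error_pos)
  have Wu_y: "Wu_y q' bt = {\<lambda>\<xi>\<in>{0..1}. oa_profile \<alpha> \<beta> r \<xi> | \<alpha> \<beta> r.
      \<beta> \<in> {0..bt} \<and> \<alpha> \<in> {-pi..pi} \<and> to_circle r = q'}" for q'
    unfolding Wu_y_eq[OF assms(2)] oa_profile_def ..
  have wasserstein: "hausdorff_dist (wasserstein p) (empirical_measure N ` Wu_theta N q bt) (M_OA bt) \<le> ennreal (?C / real N)"
    if p: "p \<ge> 1" and N: "N \<ge> 1" for p N q
  proof (rule hausdorff_dist_le)
    fix \<mu> assume "\<mu> \<in> empirical_measure N ` Wu_theta N q bt"
    then obtain x where x: "\<mu> = empirical_measure N x" "x \<in> Wu_theta N q bt" by blast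
    obtain \<alpha> \<beta> r where par: "\<beta> \<in> {0..bt}" "\<alpha> \<in> {-pi..pi}" "to_circle r = q - to_circle pi"
      and close: "\<forall>\<xi>\<in>{0..1}. dist (step_lift N x \<xi>) (oa_profile \<alpha> \<beta> r \<xi>) \<le> ?C / real N"
      using Wu_theta_close_profile[OF assms(2) N x(2)] .
    have "wasserstein p \<mu> (oa_measure \<alpha> \<beta>) \<le> ennreal (?C / real N)"
      unfolding x(1) by (rule wasserstein_empirical_oa_le[OF _ N _ _ bspec[OF close]]) (use par assms p C in auto)
    moreover have "oa_measure \<alpha> \<beta> \<in> M_OA bt"
      using par by (auto simp: M_OA_def)
    ultimately show "\<exists>\<nu>\<in>M_OA bt. wasserstein p \<mu> \<nu> \<le> ennreal (?C / real N)" by blast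
  next
    fix \<nu> assume "\<nu> \<in> M_OA bt"
    then obtain \<alpha> \<beta> where \<nu>: "\<nu> = oa_measure \<alpha> \<beta>" and par: "\<beta> \<in> {0..bt}" "\<alpha> \<in> {-pi..pi}"
      unfolding M_OA_def by blast
    \<comment> \<open>An Ott-Antonsen measure carries no phase; any representative of q - pi gives a
      profile with this law.\<close>
    obtain r where r: "to_circle r = q - to_circle pi"
      using to_circle_surj by blast
    obtain x where x: "x \<in> Wu_theta N q bt"
      and close: "\<forall>\<xi>\<in>{0..1}. dist (step_lift N x \<xi>) (oa_profile \<alpha> \<beta> r \<xi>) \<le> ?C / real N"
      using profile_close_Wu_theta[OF assms(2) N par r] .
    have "wasserstein p (empirical_measure N x) \<nu> \<le> ennreal (?C / real N)"
      unfolding \<nu> by (rule wasserstein_empirical_oa_le[OF _ N _ _ bspec[OF close]]) (use par assms p C in auto)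
    thus "\<exists>\<mu>\<in>empirical_measure N ` Wu_theta N q bt. wasserstein p \<mu> \<nu> \<le> ennreal (?C / real N)"
      using x by blast
  qed
  have linf: "hausdorff_dist linf_dist (step_lift N ` Wu_theta N q bt) (Wu_y (q - to_circle pi) bt) \<le> ennreal (?C / real N)"
    if N: "N \<ge> 1" for N q
  proof (rule hausdorff_dist_le)
    fix f assume "f \<in> step_lift N ` Wu_theta N q bt"
    then obtain x where x: "f = step_lift N x" "x \<in> Wu_theta N q bt" by blast
    obtain \<alpha> \<beta> r where par: "\<beta> \<in> {0..bt}" "\<alpha> \<in> {-pi..pi}" "to_circle r = q - to_circle pi"
      and close: "\<forall>\<xi>\<in>{0..1}. dist (step_lift N x \<xi>) (oa_profile \<alpha> \<beta> r \<xi>) \<le> ?C / real N"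
      using Wu_theta_close_profile[OF assms(2) N x(2)] .
    have "linf_dist f (\<lambda>\<xi>\<in>{0..1}. oa_profile \<alpha> \<beta> r \<xi>) \<le> ennreal (?C / real N)"
      unfolding x(1) by (rule linf_dist_step_lift_le[OF _ bspec[OF close]]) (use par assms in auto)
    moreover have "(\<lambda>\<xi>\<in>{0..1}. oa_profile \<alpha> \<beta> r \<xi>) \<in> Wu_y (q - to_circle pi) bt"
      unfolding Wu_y using par by blast
    ultimately show "\<exists>y\<in>Wu_y (q - to_circle pi) bt. linf_dist f y \<le> ennreal (?C / real N)" by blast
  next
    fix y assume "y \<in> Wu_y (q - to_circle pi) bt"
    then obtain \<alpha> \<beta> r where y: "y = (\<lambda>\<xi>\<in>{0..1}. oa_profile \<alpha> \<beta> r \<xi>)"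
      and par: "\<beta> \<in> {0..bt}" "\<alpha> \<in> {-pi..pi}" "to_circle r = q - to_circle pi"
      unfolding Wu_y by blast
    obtain x where x: "x \<in> Wu_theta N q bt"
      and close: "\<forall>\<xi>\<in>{0..1}. dist (step_lift N x \<xi>) (oa_profile \<alpha> \<beta> r \<xi>) \<le> ?C / real N"
      using profile_close_Wu_theta[OF assms(2) N par] .
    have "linf_dist (step_lift N x) y \<le> ennreal (?C / real N)"
      unfolding y by (rule linf_dist_step_lift_le[OF _ bspec[OF close]]) (use par assms in auto)
    thus "\<exists>f\<in>step_lift N ` Wu_theta N q bt. linf_dist f y \<le> ennreal (?C / real N)"
      using x by blast
  qed
  show ?thesis
  proof (intro exI[of _ ?C] conjI C allI impI)
    fix p :: real and N :: nat and q assume "p \<ge> 1" "N \<ge> 3"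
    thus "hausdorff_dist (wasserstein p) (empirical_measure N ` Wu_theta N q bt) (M_OA bt) \<le> ennreal (?C / real N)"
      "hausdorff_dist linf_dist (step_lift N ` Wu_theta N q bt) (Wu_y (q - to_circle pi) bt) \<le> ennreal (?C / real N)"
      using wasserstein[of p N q] linf[of N q] by auto
  qed
qed

end
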